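(* Let $G=(V\cup\mathcal{H},D)$ be a factor analysis graph with $|\mathcal{H}|=2$ latent nodes and $|V|=p$ observed nodes. Then $$\mathbb{V}(I(G))=\mathbb{V}\big((M_{p,2}+M_{\le 1}(G))\cap\mathbb{R}[\sigma_{ij},\ i<j]\big),$$ where the varieties $\mathbb{V}(\cdot)$ are understood over the field $\mathbb{C}$ of complex numbers.
   Context: A factor analysis graph is a directed graph $G=(V\cup\mathcal{H},D)$ where $V$ (observed nodes) and $\mathcal{H}$ (latent nodes) are finite disjoint sets and $D\subseteq\mathcal{H}\times V$; an element $(h,v)\in D$ is an edge $h\to v$. For $v\in V$ write $\mathrm{pa}(v)=\{h\in\mathcal{H}:(h,v)\in D\}$, and for $A\subseteq V$ write $\mathrm{pa}(A)=\bigcup_{a\in A}\mathrm{pa}(a)$. Identify $V$ with $\{1,\dots,p\}$. Let $\mathbb{R}^D$ be the set of real $|V|\times|\mathcal{H}|$ matrices $\Lambda=(\lambda_{vh})$ with $\lambda_{vh}=0$ whenever $(h,v)\notin D$. The factor analysis model is $F(G)=\{\Omega+\Lambda\Lambda^\top:\ \Omega \text{ diagonal } p\times p \text{ with positive diagonal},\ \Lambda\in\mathbb{R}^D\}$. The ideal of invariants of $F(G)$ is the ideal of all polynomials in the entries $\sigma_{ij}$, $i\le j$, of a symmetric matrix $\Sigma=(\sigma_{ij})$ that vanish on $F(G)$; since membership in $F(G)$ constrains only the off-diagonal entries, it is regarded as an ideal of the subring of off-diagonal variables: $I(G)=\{f\in\mathbb{R}[\sigma_{ij},\ i<j]: f(\Sigma)=0\text{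 for all }\Sigma\in F(G)\}$. $\Sigma=(\sigma_{ij})$ denotes the generic symmetric $p\times p$ matrix ($\sigma_{ij}=\sigma_{ji}$), and $\Sigma_{A,B}$ its submatrix with rows $A$ and columns $B$. $M_{p,2}\subseteq\mathbb{R}[\sigma_{ij},\ i\le j]$ is the ideal generated by all $3\times3$ minors of $\Sigma$. A set $H\subseteq\mathcal{H}$ (possibly empty) separates $A,B\subseteq V$ if $\mathrm{pa}(A)\cap\mathrm{pa}(B)\subseteq H$. $M_{\le1}(G)\subseteq\mathbb{R}[\sigma_{ij},\ i\le j]$ is the ideal generated by all minors $\det(\Sigma_{A,B})$ where $A,B\subseteq V$ (not necessarily disjoint) satisfy $|A|=|B|\le 2$ and there is $H\subseteq\mathcal{H}$ with $|H|<|A|$ such that $H$ separates $A$ and $B$. For an ideal $I\subseteq\mathbb{R}[x_1,\dots,x_n]$, $\mathbb{V}(I)=\{x\in\mathbb{C}^n: f(x)=0\text{ for all }f\in I\}$. *)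

theory Defs
  imports
    "HOL-Library.Poly_Mapping"
    "HOL-Algebra.Ideal"
    "Jordan_Normal_Form.Determinant"
    "Jordan_Normal_Form.DL_Submatrix"
begin

text \<open>
  Observed nodes are numbered from 0, so \<open>V = {..<num_obs G}\<close>. Latent nodes have a type of their
  own, which makes the two kinds of nodes disjoint.
\<close>

record 'h fa_graph =
  num_obs :: nat
  latent :: "'h set"
  edges :: "('h \<times> nat) set"

definition fa_graph :: "'h fa_graph \<Rightarrow> bool" where
  "fa_graph G \<longleftrightarrow> finite (latent G) \<and> edges G \<subseteq> latent G \<times> {..<num_obs G}"

definition parents :: "'h fa_graph \<Rightarrow> nat set \<Rightarrow> 'h set" where
  "parents G A = (\<Union>a\<in>A. {h \<in> latent G. (h, a) \<in> edges G})"

definition separates :: "'h fa_graph \<Rightarrow> 'h set \<Rightarrow> nat set \<Rightarrow> nat set \<Rightarrow> bool" where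
  "separates G H A B \<longleftrightarrow> parents G A \<inter> parents G B \<subseteq> H"

text \<open>A polynomial maps each monomial (a finitely supported exponent vector) to its coefficient.\<close>

type_synonym 'x rpoly = "('x \<Rightarrow>\<^sub>0 nat) \<Rightarrow>\<^sub>0 real"

definition Var :: "'x \<Rightarrow> 'x rpoly" where
  "Var x = Poly_Mapping.single (Poly_Mapping.single x 1) 1"

definition vars :: "'x rpoly \<Rightarrow> 'x set" where
  "vars f = (\<Union>m\<in>Poly_Mapping.keys f. Poly_Mapping.keys m)"

definition eval_poly :: "('x \<Rightarrow> 'b::{real_algebra_1, comm_ring_1}) \<Rightarrow> 'x rpoly \<Rightarrow> 'b" where
  "eval_poly x f = (\<Sum>m\<in>Poly_Mapping.keys f. of_real (Poly_Mapping.lookup f m) *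
      (\<Prod>i\<in>Poly_Mapping.keys m. x i ^ Poly_Mapping.lookup m i))"

definition poly_ring :: "'x set \<Rightarrow> 'x rpoly ring" where
  "poly_ring X = \<lparr>carrier = {f. vars f \<subseteq> X}, monoid.mult = (*), one = 1, zero = 0, add = (+)\<rparr>"

text \<open>Points of complex affine space with coordinates indexed by \<open>X\<close> are extensional functions
  on \<open>X\<close>.\<close>

definition variety :: "'x set \<Rightarrow> 'x rpoly set \<Rightarrow> ('x \<Rightarrow> complex) set" where
  "variety X I = {x \<in> X \<rightarrow>\<^sub>E UNIV. \<forall>f\<in>I. eval_poly x f = 0}"

text \<open>The pair \<open>(i, j)\<close> stands for the variable \<open>\<sigma>\<^sub>i\<^sub>j\<close>.\<close>

definition sym_vars :: "nat \<Rightarrow> (nat \<times> nat) set" where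
  "sym_vars p = {(i, j). i \<le> j \<and> j < p}"

definition offdiag_vars :: "nat \<Rightarrow> (nat \<times> nat) set" where
  "offdiag_vars p = {(i, j). i < j \<and> j < p}"

definition fa_loadings :: "'h fa_graph \<Rightarrow> (nat \<Rightarrow> 'h \<Rightarrow> real) set" where
  "fa_loadings G = {L. \<forall>v<num_obs G. \<forall>h\<in>latent G. (h, v) \<notin> edges G \<longrightarrow> L v h = 0}"

text \<open>The columns of a loading matrix \<open>L\<close> are indexed by the set \<open>latent G\<close>, so the product
  of \<open>L\<close> with its transpose is written entrywise.\<close>

definition fa_model :: "'h fa_graph \<Rightarrow> real mat set" where
  "fa_model G = (let p = num_obs G in
     {Om + mat p p (\<lambda>(i, j). \<Sum>h\<in>latent G. L i h * L j h) | Om L.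
        Om \<in> carrier_mat p p \<and> diagonal_mat Om \<and> (\<forall>i<p. Om $$ (i, i) > 0) \<and> L \<in> fa_loadings G})"

definition invariants :: "'h fa_graph \<Rightarrow> (nat \<times> nat) rpoly set" where
  "invariants G = {f \<in> carrier (poly_ring (offdiag_vars (num_obs G))).
     \<forall>S\<in>fa_model G. eval_poly (\<lambda>ij. S $$ ij) f = 0}"

definition generic_sym_mat :: "nat \<Rightarrow> (nat \<times> nat) rpoly mat" where
  "generic_sym_mat p = mat p p (\<lambda>(i, j). Var (min i j, max i j))"

abbreviation sigma_minor :: "nat \<Rightarrow> nat set \<Rightarrow> nat set \<Rightarrow> (nat \<times> nat) rpoly" where
  "sigma_minor p A B \<equiv> det (submatrix (generic_sym_mat p) A B)"

definition minors3_ideal :: "nat \<Rightarrow> (nat \<times> nat) rpoly set" where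
  "minors3_ideal p = genideal (poly_ring (sym_vars p))
     {sigma_minor p A B | A B. A \<subseteq> {..<p} \<and> B \<subseteq> {..<p} \<and> card A = 3 \<and> card B = 3}"

definition separation_ideal :: "'h fa_graph \<Rightarrow> (nat \<times> nat) rpoly set" where
  "separation_ideal G = (let p = num_obs G in genideal (poly_ring (sym_vars p))
     {sigma_minor p A B | A B. A \<subseteq> {..<p} \<and> B \<subseteq> {..<p} \<and> card A = card B \<and> card A \<le> 2 \<and>
        (\<exists>H \<subseteq> latent G. card H < card A \<and> separates G H A B)})"

text \<open>The generated ideals are meaningful: \<open>poly_ring X\<close> is a commutative ring and the minors
  belong to it.\<close>

lemma vars_add: "vars (f + g) \<subseteq> vars f \<union> vars g"
  using Poly_Mapping.keys_add[of f g] by (auto simp: vars_def)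

lemma vars_mult: "vars (f * g) \<subseteq> vars f \<union> vars g"
proof
  fix x assume "x \<in> vars (f * g)"
  then obtain m where m: "m \<in> Poly_Mapping.keys (f * g)" "x \<in> Poly_Mapping.keys m"
    by (auto simp: vars_def)
  then obtain a b where ab: "m = a + b" "a \<in> Poly_Mapping.keys f" "b \<in> Poly_Mapping.keys g"
    using keys_mult[of f g] by blast
  have "x \<in> Poly_Mapping.keys a \<union> Poly_Mapping.keys b"
    using m(2) ab(1) Poly_Mapping.keys_add[of a b] by blast
  then show "x \<in> vars f \<union> vars g"
    using ab by (auto simp: vars_def)
qed

lemma vars_simps [simp]:
  "vars 0 = {}" "vars 1 = {}" "vars (- f) = vars f" "vars (Var x) = {x}"
  by (auto simp: vars_def Var_def)

lemma cring_poly_ring: "cring (poly_ring X)"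
proof (rule cringI)
  show "abelian_group (poly_ring X)"
  proof (rule abelian_groupI)
    fix f assume f: "f \<in> carrier (poly_ring X)"
    have "- f \<in> carrier (poly_ring X)" "- f \<oplus>\<^bsub>poly_ring X\<^esub> f = \<zero>\<^bsub>poly_ring X\<^esub>"
      using f by (simp_all add: poly_ring_def)
    then show "\<exists>g\<in>carrier (poly_ring X). g \<oplus>\<^bsub>poly_ring X\<^esub> f = \<zero>\<^bsub>poly_ring X\<^esub>"
      by blast
  qed (use vars_add in \<open>force simp: poly_ring_def ac_simps\<close>)+
  show "Group.comm_monoid (poly_ring X)"
    by (rule comm_monoidI) (use vars_mult in \<open>force simp: poly_ring_def ac_simps\<close>)+
qed (simp add: poly_ring_def algebra_simps)

lemma vars_sum: "vars (sum f A) \<subseteq> (\<Union>a\<in>A. vars (f a))"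
  by (induction A rule: infinite_finite_induct) (use vars_add in force)+

lemma vars_prod: "vars (prod f A) \<subseteq> (\<Union>a\<in>A. vars (f a))"
  by (induction A rule: infinite_finite_induct) (use vars_mult in force)+

lemma sigma_minor_carrier:
  assumes "A \<subseteq> {..<p}" "B \<subseteq> {..<p}"
  shows "sigma_minor p A B \<in> carrier (poly_ring (sym_vars p))"
proof -
  let ?S = "submatrix (generic_sym_mat p) A B"
  have eqs: "{i. i < p \<and> i \<in> A} = A" "{i. i < p \<and> i \<in> B} = B"
    using assms by auto
  have fin: "finite A" "finite B"
    using assms finite_subset by blast+
  have dims: "dim_row ?S = card A" "dim_col ?S = card B"
    by (simp_all add: dim_submatrix generic_sym_mat_def eqs)
  have entry: "vars (?S $$ (i, j)) \<subseteq> sym_vars p" if "i < card A" "j < card B" for i j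
  proof -
    have "pick A i \<in> A" "pick B j \<in> B"
      using that fin by (auto intro: pick_in_set_le)
    then have "pick A i < p" "pick B j < p"
      using assms by auto
    then show ?thesis
      using that by (auto simp: submatrix_def generic_sym_mat_def eqs sym_vars_def)
  qed
  have sgn: "vars (signof q :: (nat \<times> nat) rpoly) = {}" for q :: "nat \<Rightarrow> nat"
    by (simp add: sign_def)
  show ?thesis
  proof (cases "card A = card B")
    case True
    have "vars (signof q * (\<Prod>i = 0..<card A. ?S $$ (i, q i))) \<subseteq> sym_vars p"
      if "q permutes {0..<card A}" for q
    proof -
      have "vars (?S $$ (i, q i)) \<subseteq> sym_vars p" if "i < card A" for i
        using entry[OF that, of "q i"] permutes_in_image[OF \<open>q permutes _\<close>, of i] that
        unfolding True by simp
      then have "vars (\<Prod>i = 0..<card A. ?S $$ (i, q i)) \<subseteq> sym_vars p"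
        by (intro order_trans[OF vars_prod] UN_least) simp
      then show ?thesis
        by (intro order_trans[OF vars_mult] Un_least) (simp_all only: sgn empty_subsetI)
    qed
    then have "vars (det ?S) \<subseteq> sym_vars p"
      unfolding det_def dims if_P[OF True]
      by (intro order_trans[OF vars_sum] UN_least) simp
    then show ?thesis
      by (simp add: poly_ring_def)
  next
    case False
    then show ?thesis
      by (simp add: det_def dims poly_ring_def)
  qed
qed

end

theory Submission
  imports
    "HOL-Analysis.Continuum_Not_Denumerable"
    "Jordan_Normal_Form.Char_Poly"
    Defs
begin

text \<open>
  Let \<open>K\<close> be the sum of the two ideals of minors. On a point \<open>\<Lambda> \<Lambda>\<^sup>T\<close> with \<open>\<Lambda>\<close> in the model all generators
  of \<open>K\<close> vanish, and invariants do not see the diagonal, so the elimination ideal of \<open>K\<close> consists of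
  invariants. Conversely, let \<open>x\<close> be a common zero of the elimination ideal and \<open>f\<close> an invariant with
  \<open>f(x) \<noteq> 0\<close>. No power of \<open>f\<close> lies in \<open>K\<close>, so the Nullstellensatz yields a complex
  symmetric matrix on which \<open>K\<close> vanishes but \<open>f\<close> does not. Such a matrix has rank at most two and is
  therefore a Gram matrix of vectors in \<open>\<complex>\<^sup>2\<close> for the bilinear dot product. The separation minors put
  the vectors of the nodes with a single parent on two orthogonal lines. These lines need not be
  the coordinate axes up to a rotation, since over \<open>\<complex>\<close> they can be isotropic. But all such
  configurations have a common polynomial parametrization, whose real points do lie in the model up
  to rotation, and a polynomial that vanishes at the real points vanishes everywhere.
\<close>

section \<open>A Nullstellensatz for real algebras of countable dimension\<close>

text \<open>Gaussian elimination on the last coordinate: a vector that is nonzero there serves as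
  pivot and clears it from the others. The vectors form a family over \<open>T\<close>, so equal
  vectors at different indices count separately.\<close>

lemma nontrivial_linear_relation:
  fixes a :: "'c \<Rightarrow> nat \<Rightarrow> 'f::field"
  assumes "finite T" "d < card T"
  shows "\<exists>b. (\<exists>c\<in>T. b c \<noteq> 0) \<and> (\<forall>k<d. (\<Sum>c\<in>T. b c * a c k) = 0)"
  using assms
proof (induction d arbitrary: T a)
  case 0
  then have "T \<noteq> {}" by auto
  then show ?case by (intro exI[of _ "\<lambda>_. 1"]) auto
next
  case (Suc d)
  show ?case
  proof (cases "\<forall>c\<in>T. a c d = 0")
    case True
    from Suc.IH[of T a] Suc.prems obtain b
      where "\<exists>c\<in>T. b c \<noteq> 0" "\<forall>k<d. (\<Sum>c\<in>T. b c * a c k) = 0" by auto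
    then show ?thesis
      using True by (intro exI[of _ b]) (auto simp: less_Suc_eq)
  next
    case False
    then obtain c0 where c0: "c0 \<in> T" "a c0 d \<noteq> 0" by blast
    define a' where "a' c k = a c k - a c d / a c0 d * a c0 k" for c k
    have "finite (T - {c0})" "d < card (T - {c0})" using Suc.prems c0 by auto
    from Suc.IH[OF this, of a'] obtain b where
      b: "\<exists>c\<in>T - {c0}. b c \<noteq> 0" "\<And>k. k < d \<Longrightarrow> (\<Sum>c\<in>T - {c0}. b c * a' c k) = 0" by blast
    \<comment> \<open>The coefficient of the pivot is the one that makes coordinate \<open>d\<close>
      cancel.\<close>
    define b' where "b' c = (if c = c0 then - (\<Sum>c\<in>T - {c0}. b c * a c d) / a c0 d else b c)" for c
    have split: "(\<Sum>c\<in>T. b' c * a c k) = b' c0 * a c0 k + (\<Sum>c\<in>T - {c0}. b c * a c k)" for k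
    proof -
      have "(\<Sum>c\<in>T. b' c * a c k) = b' c0 * a c0 k + (\<Sum>c\<in>T - {c0}. b' c * a c k)"
        by (rule sum.remove[OF Suc.prems(1) c0(1)])
      also have "(\<Sum>c\<in>T - {c0}. b' c * a c k) = (\<Sum>c\<in>T - {c0}. b c * a c k)"
        by (rule sum.cong) (auto simp: b'_def)
      finally show ?thesis .
    qed
    have "(\<Sum>c\<in>T. b' c * a c k) = 0" if "k < Suc d" for k
    proof (cases "k = d")
      case True
      then show ?thesis using c0(2) unfolding split by (simp add: b'_def)
    next
      case False
      with that have "(\<Sum>c\<in>T - {c0}. b c * a' c k) = 0" by (intro b(2)) simp
      moreover have "(\<Sum>c\<in>T - {c0}. b c * a' c k)
          = (\<Sum>c\<in>T - {c0}. b c * a c k) - (\<Sum>c\<in>T - {c0}. b c * a c d) / a c0 d * a c0 k"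
        by (simp add: a'_def algebra_simps sum_subtractf sum_distrib_left sum_divide_distrib)
      ultimately show ?thesis unfolding split by (simp add: b'_def)
    qed
    moreover have "\<exists>c\<in>T. b' c \<noteq> 0" using b(1) by (auto simp: b'_def)
    ultimately show ?thesis by blast
  qed
qed

text \<open>The algebra is a subset \<open>S\<close> of a ring type, so that polynomials in any
  chosen set of variables are covered. Countable dimension over the uncountable field of reals
  drives the Nullstellensatz below.\<close>

locale countable_real_algebra = comm_ring_hom C
  for C :: "real \<Rightarrow> 'a::comm_ring_1" +
  fixes S :: "'a set"
  assumes C_in [simp, intro]: "C r \<in> S"
    and add_in [simp, intro]: "a \<in> S \<Longrightarrow> b \<in> S \<Longrightarrow> a + b \<in> S"
    and mult_in [simp, intro]: "a \<in> S \<Longrightarrow> b \<in> S \<Longrightarrow> a * b \<in> S"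
    and countable_span: "\<exists>e. \<forall>g\<in>S. \<exists>d a. g = (\<Sum>k<d. C (a k) * e (k::nat))"
begin

lemma zero_in [simp]: "0 \<in> S" and one_in [simp]: "1 \<in> S"
  using C_in[of 0] C_in[of 1] by simp_all

lemma uminus_in [simp, intro]: "a \<in> S \<Longrightarrow> - a \<in> S"
  using mult_in[OF C_in[of "-1"], of a] by (simp add: hom_uminus)

lemma diff_in [simp, intro]: "a \<in> S \<Longrightarrow> b \<in> S \<Longrightarrow> a - b \<in> S"
  using add_in[of a "- b"] by simp

lemma power_in [simp, intro]: "a \<in> S \<Longrightarrow> a ^ n \<in> S"
  by (induction n) auto

lemma sum_in [intro]: "(\<And>i. i \<in> T \<Longrightarrow> u i \<in> S) \<Longrightarrow> sum u T \<in> S"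
  by (induction T rule: infinite_finite_induct) auto

lemma prod_in [intro]: "(\<And>i. i \<in> T \<Longrightarrow> u i \<in> S) \<Longrightarrow> prod u T \<in> S"
  by (induction T rule: infinite_finite_induct) auto

text \<open>Ideals of \<open>S\<close>, not of the ambient ring: the multipliers range over
  \<open>S\<close> only.\<close>

definition subideal :: "'a set \<Rightarrow> bool" where
  "subideal I \<longleftrightarrow> I \<subseteq> S \<and> 0 \<in> I \<and> (\<forall>a\<in>I. \<forall>b\<in>I. a + b \<in> I) \<and> (\<forall>s\<in>S. \<forall>a\<in>I. s * a \<in> I)"

lemma subidealD:
  assumes "subideal I"
  shows "a \<in> I \<Longrightarrow> a \<in> S" "0 \<in> I" "a \<in> I \<Longrightarrow> b \<in> I \<Longrightarrow> a + b \<in> I"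
    "s \<in> S \<Longrightarrow> a \<in> I \<Longrightarrow> s * a \<in> I" "s \<in> S \<Longrightarrow> a \<in> I \<Longrightarrow> a * s \<in> I"
  using assms by (auto simp: subideal_def mult.commute)

lemma subideal_uminus: "subideal I \<Longrightarrow> a \<in> I \<Longrightarrow> - a \<in> I"
  using subidealD(4)[of I "-1" a] by simp

lemma subideal_diff: "subideal I \<Longrightarrow> a \<in> I \<Longrightarrow> b \<in> I \<Longrightarrow> a - b \<in> I"
  using subidealD(3)[of I a "- b"] subideal_uminus[of I b] by simp

lemma subideal_sum: "subideal I \<Longrightarrow> (\<And>i. i \<in> T \<Longrightarrow> u i \<in> I) \<Longrightarrow> sum u T \<in> I"
  by (induction T rule: infinite_finite_induct) (auto intro: subidealD)

lemma subideal_extend: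
  assumes "subideal I" "a \<in> S"
  shows "subideal {x + s * a | x s. x \<in> I \<and> s \<in> S}"
  unfolding subideal_def
proof (intro conjI ballI)
  show "{x + s * a | x s. x \<in> I \<and> s \<in> S} \<subseteq> S"
    using assms subidealD(1)[OF assms(1)] by auto
  have "0 = 0 + 0 * a" by simp
  then show "0 \<in> {x + s * a | x s. x \<in> I \<and> s \<in> S}"
    using subidealD(2)[OF assms(1)] zero_in by blast
next
  fix u v assume "u \<in> {x + s * a | x s. x \<in> I \<and> s \<in> S}" "v \<in> {x + s * a | x s. x \<in> I \<and> s \<in> S}"
  then obtain x s x' s' where *: "x \<in> I" "s \<in> S" "x' \<in> I" "s' \<in> S" "u = x + s * a" "v = x' + s' * a"
    by blast
  then have "u + v = (x + x') + (s + s') * a" by (simp add: algebra_simps)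
  then show "u + v \<in> {x + s * a | x s. x \<in> I \<and> s \<in> S}"
    using * subidealD(3)[OF assms(1)] add_in by blast
next
  fix t u assume "t \<in> S" "u \<in> {x + s * a | x s. x \<in> I \<and> s \<in> S}"
  then obtain x s where *: "x \<in> I" "s \<in> S" "u = x + s * a" by blast
  then have "t * u = t * x + (t * s) * a" by (simp add: algebra_simps)
  then show "t * u \<in> {x + s * a | x s. x \<in> I \<and> s \<in> S}"
    using * \<open>t \<in> S\<close> subidealD(4)[OF assms(1)] mult_in by blast
qed

text \<open>Zorn's lemma. The last property is maximality, applied to the ideal generated by
  \<open>P\<close> and \<open>a\<close>: modulo \<open>P\<close>, every element outside
  \<open>P\<close> divides a power of \<open>f\<close>. So \<open>P\<close> corresponds to a maximal
  ideal of the localization at \<open>f\<close>.\<close>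

lemma maximal_ideal_avoiding_powers:
  assumes K: "subideal K" and f: "\<And>n. f ^ n \<notin> K"
  obtains P where "subideal P" "K \<subseteq> P" "\<And>n. f ^ n \<notin> P"
    "\<And>a. a \<in> S \<Longrightarrow> a \<notin> P \<Longrightarrow> \<exists>n s. s \<in> S \<and> f ^ n - s * a \<in> P"
proof -
  define \<A> where "\<A> = {I. subideal I \<and> K \<subseteq> I \<and> (\<forall>n. f ^ n \<notin> I)}"
  have ne: "\<A> \<noteq> {}" using K f by (auto simp: \<A>_def)
  have chains: "\<Union>\<C> \<in> \<A>" if \<C>: "\<C> \<noteq> {}" "subset.chain \<A> \<C>" for \<C>
  proof -
    have mem: "\<And>I. I \<in> \<C> \<Longrightarrow> subideal I \<and> K \<subseteq> I \<and> (\<forall>n. f ^ n \<notin> I)"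
      and tot: "\<And>I J. I \<in> \<C> \<Longrightarrow> J \<in> \<C> \<Longrightarrow> I \<subseteq> J \<or> J \<subseteq> I"
      using \<C>(2) by (auto simp: subset.chain_def \<A>_def)
    obtain I0 where I0: "I0 \<in> \<C>" using \<C>(1) by blast
    have "subideal (\<Union>\<C>)"
      unfolding subideal_def
    proof (intro conjI ballI)
      show "\<Union>\<C> \<subseteq> S" using mem subidealD(1) by blast
      show "0 \<in> \<Union>\<C>" using I0 mem subidealD(2) by blast
    next
      fix a b assume "a \<in> \<Union>\<C>" "b \<in> \<Union>\<C>"
      then obtain I J where "I \<in> \<C>" "J \<in> \<C>" "a \<in> I" "b \<in> J" by blast
      then show "a + b \<in> \<Union>\<C>"
        using tot[of I J] mem subidealD(3) by (metis UnionI subsetD)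
    next
      fix s a assume "s \<in> S" "a \<in> \<Union>\<C>"
      then show "s * a \<in> \<Union>\<C>" using mem subidealD(4) by blast
    qed
    then show ?thesis using I0 mem by (auto simp: \<A>_def)
  qed
  obtain P where P: "P \<in> \<A>" and max: "\<And>X. X \<in> \<A> \<Longrightarrow> P \<subseteq> X \<Longrightarrow> X = P"
    using subset_Zorn_nonempty[OF ne chains] by blast
  have Pi: "subideal P" "K \<subseteq> P" "\<And>n. f ^ n \<notin> P" using P by (auto simp: \<A>_def)
  have "\<exists>n s. s \<in> S \<and> f ^ n - s * a \<in> P" if a: "a \<in> S" "a \<notin> P" for a
  proof -
    let ?Q = "{x + s * a | x s. x \<in> P \<and> s \<in> S}"
    have "subideal ?Q" by (rule subideal_extend[OF Pi(1) a(1)])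
    moreover have PQ: "P \<subseteq> ?Q"
    proof
      fix x assume "x \<in> P"
      then have "x = x + 0 * a \<and> x \<in> P \<and> 0 \<in> S" by simp
      then show "x \<in> ?Q" by blast
    qed
    moreover have "a = 0 + 1 * a \<and> 0 \<in> P \<and> 1 \<in> S" using subidealD(2)[OF Pi(1)] by simp
    then have "a \<in> ?Q" by blast
    then have "?Q \<noteq> P" using a(2) by blast
    then have "?Q \<notin> \<A>" using max[OF _ PQ] by blast
    ultimately obtain n where "f ^ n \<in> ?Q" using Pi(2) unfolding \<A>_def by blast
    then obtain x s where "f ^ n = x + s * a" "x \<in> P" "s \<in> S" by blast
    then show ?thesis by (intro exI[of _ n] exI[of _ s]) simp
  qed
  with Pi that show ?thesis by blast
qed

text \<open>If \<open>a\<close> and \<open>b\<close> both divide powers of \<open>f\<close> modulo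
  \<open>P\<close>, then so does \<open>a * b\<close>, which therefore cannot lie in
  \<open>P\<close>.\<close>

lemma maximal_ideal_avoiding_powers_prime:
  assumes P: "subideal P" and f: "f \<in> S" "\<And>n. f ^ n \<notin> P"
    and max: "\<And>a. a \<in> S \<Longrightarrow> a \<notin> P \<Longrightarrow> \<exists>n s. s \<in> S \<and> f ^ n - s * a \<in> P"
    and ab: "a \<in> S" "b \<in> S" "a * b \<in> P"
  shows "a \<in> P \<or> b \<in> P"
proof (rule ccontr)
  assume "\<not> ?thesis"
  then obtain n s m t where *: "s \<in> S" "f ^ n - s * a \<in> P" "t \<in> S" "f ^ m - t * b \<in> P"
    using max[OF ab(1)] max[OF ab(2)] by blast
  have "f ^ (n + m) = f ^ m * (f ^ n - s * a) + (s * a) * (f ^ m - t * b) + (s * t) * (a * b)"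
    by (simp add: power_add algebra_simps)
  also have "\<dots> \<in> P"
    using subidealD(4)[OF P _ *(2), of "f ^ m"] subidealD(4)[OF P _ *(4), of "s * a"]
      subidealD(4)[OF P _ ab(3), of "s * t"] subidealD(3)[OF P] *(1,3) ab f(1) by simp
  finally show False using f(2) by blast
qed

section \<open>Elements of the algebra as roots of real polynomials modulo an ideal\<close>

abbreviation evalC :: "real poly \<Rightarrow> 'a \<Rightarrow> 'a" where
  "evalC q z \<equiv> poly (map_poly C q) z"

interpretation coeff_hom: map_poly_comm_ring_hom C ..

lemma evalC_simps:
  "evalC (p + q) z = evalC p z + evalC q z" "evalC (p * q) z = evalC p z * evalC q z"
  "evalC (Polynomial.smult r q) z = C r * evalC q z" "evalC [:r:] z = C r" "evalC 1 z = 1"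
  "evalC 0 z = 0" "evalC [:r, 1:] z = C r + z" "evalC [:r, r', 1:] z = C r + C r' * z + z * z"
  by (simp_all add: hom_distribs algebra_simps map_poly_pCons)

lemma evalC_sum: "evalC (sum u T) z = (\<Sum>i\<in>T. evalC (u i) z)"
  by (induction T rule: infinite_finite_induct) (simp_all add: evalC_simps)

lemma evalC_prod: "evalC (prod u T) z = (\<Prod>i\<in>T. evalC (u i) z)"
  by (induction T rule: infinite_finite_induct) (simp_all add: evalC_simps)

lemma evalC_in: "z \<in> S \<Longrightarrow> evalC q z \<in> S"
  by (induction q) (auto simp: map_poly_pCons hom_distribs)

text \<open>If no \<open>z - c\<close> lay in \<open>P\<close>, then each would divide a power of \<open>f\<close> modulo \<open>P\<close>. Uncountably many
  of these cofactors cannot be linearly independent, and a linear relation between them, multiplied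
  by the product of the \<open>z - c\<close>, becomes an algebraic equation for \<open>z\<close>.\<close>

lemma algebraic_mod_maximal_ideal:
  assumes P: "subideal P" and f: "f \<in> S" "\<And>n. f ^ n \<notin> P"
    and max: "\<And>a. a \<in> S \<Longrightarrow> a \<notin> P \<Longrightarrow> \<exists>n s. s \<in> S \<and> f ^ n - s * a \<in> P"
    and z: "z \<in> S"
  shows "\<exists>q. q \<noteq> 0 \<and> evalC q z \<in> P"
proof (cases "\<exists>c. z - C c \<in> P")
  case True
  then obtain c where "z - C c \<in> P" by blast
  then show ?thesis
    by (intro exI[of _ "[:- c, 1:]"]) (simp add: evalC_simps hom_uminus)
next
  case False
  obtain e where e: "\<And>g. g \<in> S \<Longrightarrow> \<exists>d a. g = (\<Sum>k<d. C (a k) * e (k::nat))"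
    using countable_span by blast
  \<comment> \<open>Membership of the sum in \<open>S\<close> is recorded separately, since the
    spanning elements \<open>e k\<close> may lie outside \<open>S\<close>.\<close>
  have "\<exists>n d a. f ^ n - (\<Sum>k<d. C (a k) * e k) * (z - C c) \<in> P \<and> (\<Sum>k<d. C (a k) * e k) \<in> S" for c
  proof -
    obtain n s where "s \<in> S" "f ^ n - s * (z - C c) \<in> P"
      using max[of "z - C c"] False z by blast
    with e[of s] show ?thesis by auto
  qed
  then obtain n d a where g: "\<And>c. f ^ n c - (\<Sum>k<d c. C (a c k) * e k) * (z - C c) \<in> P"
      "\<And>c. (\<Sum>k<d c. C (a c k) * e k) \<in> S"
    by metis
  \<comment> \<open>There are countably many pairs of an exponent and a length but uncountably many
    \<open>c\<close>, so one pair serves infinitely many \<open>c\<close>.\<close>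
  have "\<exists>N D. infinite {c. n c = N \<and> d c = D}"
  proof (rule ccontr)
    assume "\<not> ?thesis"
    then have "countable (\<Union>w. {c. n c = fst w \<and> d c = snd w})"
      by (intro countable_UN) (auto intro: countable_finite)
    moreover have "(\<Union>w. {c. n c = fst w \<and> d c = snd w}) = UNIV" by auto
    ultimately show False using uncountable_UNIV_real by simp
  qed
  then obtain N D where "infinite {c. n c = N \<and> d c = D}" by blast
  then obtain T where T: "T \<subseteq> {c. n c = N \<and> d c = D}" "card T = Suc D" "finite T"
    using infinite_arbitrarily_large by blast
  obtain b where b: "\<exists>c\<in>T. b c \<noteq> 0" "\<And>k. k < D \<Longrightarrow> (\<Sum>c\<in>T. b c * a c k) = 0"
    using nontrivial_linear_relation[OF T(3), of D a] T(2) by auto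
  define g' where "g' c = (\<Sum>k<D. C (a c k) * e k)" for c
  have g': "f ^ N - g' c * (z - C c) \<in> P" "g' c \<in> S" if "c \<in> T" for c
    using g[of c] T(1) that by (auto simp: g'_def)
  \<comment> \<open>The numerator of the sum of the fractions b(c) / (X - c). At a point
    \<open>c\<close> of \<open>T\<close> every summand but its own vanishes, which shows that
    \<open>q\<close> is nonzero.\<close>
  define q where "q = (\<Sum>c\<in>T. Polynomial.smult (b c) (\<Prod>l\<in>T - {c}. [:- l, 1:]))"
  have "q \<noteq> 0"
  proof -
    obtain c where c: "c \<in> T" "b c \<noteq> 0" using b(1) by blast
    have "poly q c = (\<Sum>c'\<in>T. b c' * (\<Prod>l\<in>T - {c'}. c - l))"
      by (simp add: q_def poly_sum poly_prod)
    also have "\<dots> = (\<Sum>c'\<in>T. if c' = c then b c * (\<Prod>l\<in>T - {c}. c - l) else 0)"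
      using c(1) T(3) by (intro sum.cong) (auto intro!: prod_zero)
    also have "\<dots> \<noteq> 0" using c T(3) by simp
    finally show ?thesis by auto
  qed
  let ?pr = "\<lambda>c. \<Prod>l\<in>T - {c}. z - C l"
  have q: "evalC q z = (\<Sum>c\<in>T. C (b c) * ?pr c)"
    by (simp add: q_def evalC_sum evalC_prod evalC_simps hom_uminus)
  have "(\<Sum>c\<in>T. C (b c) * g' c) = 0"
  proof -
    have "(\<Sum>c\<in>T. C (b c) * g' c) = (\<Sum>c\<in>T. \<Sum>k<D. C (b c * a c k) * e k)"
      by (simp add: g'_def sum_distrib_left hom_mult mult.assoc)
    also have "\<dots> = (\<Sum>k<D. C (\<Sum>c\<in>T. b c * a c k) * e k)"
      by (subst sum.swap) (simp add: hom_sum sum_distrib_right)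
    finally show ?thesis by (simp add: b)
  qed
  moreover have "(\<Sum>c\<in>T. C (b c) * ?pr c * (g' c * (z - C c)))
      = (\<Sum>c\<in>T. C (b c) * g' c) * (\<Prod>l\<in>T. z - C l)"
    unfolding sum_distrib_right
    using T(3) by (intro sum.cong) (simp_all add: prod.remove[OF T(3)] algebra_simps)
  ultimately have "f ^ N * evalC q z = (\<Sum>c\<in>T. C (b c) * ?pr c * (f ^ N - g' c * (z - C c)))"
    by (simp add: q right_diff_distrib sum_subtractf sum_distrib_left mult_ac)
  also have "\<dots> \<in> P"
    using g' z by (intro subideal_sum[OF P] subidealD(4)[OF P]) auto
  finally have "f ^ N * evalC q z \<in> P" .
  then have "evalC q z \<in> P"
    using maximal_ideal_avoiding_powers_prime[OF P f max] f evalC_in[OF z] by blast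
  with \<open>q \<noteq> 0\<close> show ?thesis by blast
qed

text \<open>A real polynomial splits into linear factors and quadratic factors without real roots,
  and a prime ideal contains the value of one of them. A linear factor is squared and gives
  \<open>b = 0\<close>; a nonzero constant would put 1 into \<open>P\<close>.\<close>

lemma quadratic_mod_prime:
  assumes P: "subideal P" "1 \<notin> P" and prime: "\<And>a b. a \<in> S \<Longrightarrow> b \<in> S \<Longrightarrow> a * b \<in> P \<Longrightarrow> a \<in> P \<or> b \<in> P"
    and z: "z \<in> S" and q: "q \<noteq> 0" "evalC q z \<in> P"
  shows "\<exists>a b. (z - C a)\<^sup>2 + (C b)\<^sup>2 \<in> P"
  using q
proof (induction "degree q" arbitrary: q rule: less_induct)
  case less
  show ?case
  proof (cases "degree q = 0")
    case True
    then obtain r where r: "q = [:r:]" by (auto elim: degree_eq_zeroE)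
    then have "C (inverse r) * C r \<in> P" using less.prems by (intro subidealD(4)[OF P(1)]) (auto simp: evalC_simps)
    then show ?thesis using r less.prems(1) P(2) by (simp flip: hom_mult)
  next
    case False
    then have "degree (map_poly of_real q :: complex poly) \<noteq> 0" by simp
    then obtain c where c: "poly (map_poly of_real q) c = (0::complex)"
      using fundamental_theorem_of_algebra[of "map_poly of_real q"] by (auto simp: constant_degree)
    \<comment> \<open>The minimal polynomial of \<open>c\<close> over the reals; for non-real
      \<open>c\<close> its roots are \<open>c\<close> and its conjugate.\<close>
    define w where "w = (if Im c = 0 then [:- Re c, 1:] else [:(Re c)\<^sup>2 + (Im c)\<^sup>2, - 2 * Re c, 1:])"
    have "w dvd q"
    proof (cases "Im c = 0")
      case True
      then have "c = of_real (Re c)" by (simp add: complex_eq_iff)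
      then have "poly q (Re c) = 0" using c by (metis of_real_eq_0_iff of_real_hom.poly_map_poly)
      then show ?thesis using True by (simp add: w_def poly_eq_0_iff_dvd)
    next
      case False
      have w: "w = [:(Re c)\<^sup>2 + (Im c)\<^sup>2, - 2 * Re c, 1:]" using False by (simp add: w_def)
      have dw: "degree w = 2" by (simp add: w)
      have w0: "poly (map_poly of_real w) c = 0"
        by (simp add: w complex_eq_iff power2_eq_square algebra_simps)
      have "poly (map_poly of_real r) c = 0" if "q = k * w + r" for k r
      proof -
        interpret of_real: map_poly_comm_ring_hom "of_real :: real \<Rightarrow> complex" ..
        show ?thesis using c w0 by (simp add: that of_real.hom_add of_real.hom_mult)
      qed
      from this[OF div_mult_mod_eq[symmetric]] have "poly (map_poly of_real (q mod w)) c = 0" .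
      \<comment> \<open>A real polynomial of degree at most one that vanishes at a non-real point is
        zero.\<close>
      moreover have "degree (q mod w) < 2"
        using degree_mod_less[of w q] dw by (cases "w = 0"; cases "q mod w = 0") auto
      then have "q mod w = [:coeff (q mod w) 0, coeff (q mod w) 1:]"
        by (intro poly_eqI) (auto simp: coeff_pCons coeff_eq_0 split: nat.split)
      then obtain s t where st: "q mod w = [:s, t:]" by blast
      ultimately have "s + t * Re c = 0" "t * Im c = 0"
        by (auto simp: of_real_hom.map_poly_pCons_hom complex_eq_iff algebra_simps)
      with False have "q mod w = 0" using st by simp
      then show ?thesis by auto
    qed
    then obtain r where r: "q = w * r" by (elim dvdE)
    have nz: "w \<noteq> 0" "r \<noteq> 0" using r less.prems by auto
    have "degree w > 0" by (simp add: w_def)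
    then have "degree r < degree q" using nz by (simp add: r degree_mult_eq)
    have "evalC w z * evalC r z \<in> P" using less.prems by (simp add: r evalC_simps)
    then consider "evalC w z \<in> P" | "evalC r z \<in> P" using prime evalC_in[OF z] by blast
    then show ?thesis
    proof cases
      case 1
      show ?thesis
      proof (cases "Im c = 0")
        case True
        then have "z - C (Re c) \<in> P" using 1 by (simp add: w_def evalC_simps hom_uminus)
        then have "(z - C (Re c))\<^sup>2 + (C 0)\<^sup>2 \<in> P"
          using z subidealD(4)[OF P(1), of "z - C (Re c)"] by (simp add: power2_eq_square)
        then show ?thesis by blast
      next
        case False
        have "(z - C (Re c))\<^sup>2 + (C (Im c))\<^sup>2 = evalC w z"
          using False
          by (simp add: w_def evalC_simps hom_distribs power2_eq_square algebra_simps)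
        then show ?thesis using 1 by metis
      qed
    next
      case 2
      then show ?thesis using less.hyps[OF \<open>degree r < degree q\<close> nz(2)] by blast
    qed
  qed
qed

text \<open>Modulo the ideal \<open>P\<close> obtained from Zorn's lemma every element of
  \<open>S\<close> is a root of some (X - a)^2 + b^2, so the residue ring is the field of real or of
  complex numbers. The residue map is \<open>\<phi>\<close>, defined by choice and controlled on
  \<open>S\<close>.\<close>

theorem nullstellensatz:
  assumes K: "subideal K" and f: "f \<in> S" "\<And>n. f ^ n \<notin> K"
  obtains \<phi> :: "'a \<Rightarrow> complex" where
    "\<And>a b. a \<in> S \<Longrightarrow> b \<in> S \<Longrightarrow> \<phi> (a + b) = \<phi> a + \<phi> b"
    "\<And>a b. a \<in> S \<Longrightarrow> b \<in> S \<Longrightarrow> \<phi> (a * b) = \<phi> a * \<phi> b"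
    "\<And>r. \<phi> (C r) = of_real r" "\<And>a. a \<in> K \<Longrightarrow> \<phi> a = 0" "\<phi> f \<noteq> 0"
proof -
  obtain P where P: "subideal P" "K \<subseteq> P" and fP: "\<And>n. f ^ n \<notin> P"
    and max: "\<And>a. a \<in> S \<Longrightarrow> a \<notin> P \<Longrightarrow> \<exists>n s. s \<in> S \<and> f ^ n - s * a \<in> P"
    using maximal_ideal_avoiding_powers[OF K f(2)] by blast
  note prime = maximal_ideal_avoiding_powers_prime[OF P(1) f(1) fP max]
  have one: "1 \<notin> P" using fP[of 0] by simp
  have quad: "\<exists>a b. (z - C a)\<^sup>2 + (C b)\<^sup>2 \<in> P" if "z \<in> S" for z
    using algebraic_mod_maximal_ideal[OF P(1) f(1) fP max that]
      quadratic_mod_prime[OF P(1) one prime that] by blast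
  have unit: "C r \<notin> P" if "r \<noteq> 0" for r
  proof
    assume "C r \<in> P"
    then have "C (inverse r) * C r \<in> P" by (intro subidealD(4)[OF P(1)]) auto
    then show False using one that by (simp flip: hom_mult)
  qed
  \<comment> \<open>\<open>y\<close> represents the imaginary unit modulo \<open>P\<close>; the
    value 0 marks the case in which all residues are real.\<close>
  have "\<exists>y\<in>S. y\<^sup>2 + 1 \<in> P \<and> (\<forall>z\<in>S. \<exists>a b. z - C a - C b * y \<in> P) \<or>
      y = 0 \<and> (\<forall>z\<in>S. \<exists>a. z - C a \<in> P)"
  proof (cases "\<forall>z\<in>S. \<exists>a. z - C a \<in> P")
    case True
    then show ?thesis using zero_in by blast
  next
    case False
    then obtain x where x: "x \<in> S" "\<And>a. x - C a \<notin> P" by blast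
    obtain a b where ab: "(x - C a)\<^sup>2 + (C b)\<^sup>2 \<in> P" using quad[OF x(1)] by blast
    have "b \<noteq> 0"
      using ab prime[of "x - C a" "x - C a"] x by (auto simp: power2_eq_square)
    define y where "y = C (inverse b) * (x - C a)"
    have y: "y \<in> S" using x by (simp add: y_def)
    have "(C (inverse b))\<^sup>2 * (C b)\<^sup>2 = (C (inverse b * b))\<^sup>2"
      by (simp only: hom_mult power_mult_distrib)
    then have "(C (inverse b))\<^sup>2 * (C b)\<^sup>2 = 1" using \<open>b \<noteq> 0\<close> by simp
    then have "y\<^sup>2 + 1 = (C (inverse b))\<^sup>2 * ((x - C a)\<^sup>2 + (C b)\<^sup>2)"
      by (simp add: y_def power_mult_distrib distrib_left)
    also have "\<dots> \<in> P" using ab by (intro subidealD(4)[OF P(1)]) auto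
    finally have y2: "y\<^sup>2 + 1 \<in> P" .
    have "\<exists>a b. z - C a - C b * y \<in> P" if z: "z \<in> S" for z
    proof -
      obtain s t where st: "(z - C s)\<^sup>2 + (C t)\<^sup>2 \<in> P" using quad[OF z] by blast
      \<comment> \<open>As the square of \<open>y\<close> is -1 modulo \<open>P\<close>, the
        quadratic splits into two linear factors.\<close>
      have "(z - C s - C t * y) * (z - C s - C (- t) * y)
          = ((z - C s)\<^sup>2 + (C t)\<^sup>2) - (C t)\<^sup>2 * (y\<^sup>2 + 1)"
        by (simp add: hom_distribs power2_eq_square algebra_simps)
      also have "\<dots> \<in> P" using st y2 by (intro subideal_diff[OF P(1)] subidealD(4)[OF P(1)]) auto
      finally have "z - C s - C t * y \<in> P \<or> z - C s - C (- t) * y \<in> P"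
        using z y by (intro prime) auto
      then show ?thesis by blast
    qed
    with y y2 show ?thesis by blast
  qed
  then obtain y where y: "y \<in> S" and cases:
    "y\<^sup>2 + 1 \<in> P \<and> (\<forall>z\<in>S. \<exists>a b. z - C a - C b * y \<in> P) \<or> y = 0 \<and> (\<forall>z\<in>S. \<exists>a. z - C a \<in> P)" by blast
  define val where "val c = C (Re c) + C (Im c) * y" for c
  \<comment> \<open>If \<open>y = 0\<close>, the imaginary part of \<open>c\<close> has no effect on
    \<open>val c\<close>; fixing it to 0 keeps \<open>c\<close> unique.\<close>
  define rel where "rel z c \<longleftrightarrow> z \<in> S \<and> z - val c \<in> P \<and> (y = 0 \<longrightarrow> Im c = 0)" for z c
  have val_in: "val c \<in> S" for c using y by (simp add: val_def)
  have ex: "\<exists>c. rel z c" if "z \<in> S" for z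
  proof (cases "y = 0")
    case True
    then have "\<exists>a. z - C a \<in> P"
      using cases that one by (auto simp: power2_eq_square)
    then obtain a where "z - C a \<in> P" by blast
    with True that have "rel z (of_real a)" by (simp add: rel_def val_def)
    then show ?thesis by blast
  next
    case False
    then obtain a b where "z - C a - C b * y \<in> P" using cases \<open>z \<in> S\<close> by blast
    with False that have "rel z (Complex a b)" by (simp add: rel_def val_def diff_diff_eq)
    then show ?thesis by blast
  qed
  have add: "rel (z + z') (c + c')" if "rel z c" "rel z' c'" for z z' c c'
  proof -
    have "z + z' - val (c + c') = (z - val c) + (z' - val c')"
      by (simp add: val_def hom_distribs algebra_simps)
    also have "\<dots> \<in> P" using that by (intro subidealD(3)[OF P(1)]) (auto simp: rel_def)
    finally show ?thesis using that by (auto simp: rel_def)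
  qed
  \<comment> \<open>If \<open>y = 0\<close>, the second factor is 1 and lies outside
    \<open>P\<close>, but then \<open>Im c\<close> is 0.\<close>
  have y2: "C (Im c * Im c') * (y\<^sup>2 + 1) \<in> P" if "rel z c" for z c c'
    using cases that y by (auto simp: rel_def subidealD[OF P(1)])
  have mult: "rel (z * z') (c * c')" if "rel z c" "rel z' c'" for z z' c c'
  proof -
    have "z * z' - val (c * c') =
        z * (z' - val c') + val c' * (z - val c) + C (Im c * Im c') * (y\<^sup>2 + 1)"
      by (simp add: val_def hom_distribs power2_eq_square algebra_simps)
    also have "\<dots> \<in> P"
      using that val_in subidealD(3,4)[OF P(1)] y2[OF that(1), of c'] by (simp add: rel_def)
    finally show ?thesis using that by (auto simp: rel_def)
  qed
  have zero: "c = 0" if "rel z c" "z \<in> P" for z c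
  proof (rule ccontr)
    assume "c \<noteq> 0"
    have "val c \<in> P" using that subideal_diff[OF P(1), of z "z - val c"] by (simp add: rel_def)
    \<comment> \<open>The product of \<open>c\<close> with its conjugate is a real constant in
      \<open>P\<close>, hence zero.\<close>
    have "C ((Re c)\<^sup>2 + (Im c)\<^sup>2) = (C (Re c) - C (Im c) * y) * val c + C (Im c * Im c) * (y\<^sup>2 + 1)"
      by (simp add: val_def hom_distribs power2_eq_square algebra_simps)
    also have "\<dots> \<in> P"
      using \<open>val c \<in> P\<close> y subidealD(3,4)[OF P(1)] y2[OF that(1), of c] by simp
    finally have "C ((Re c)\<^sup>2 + (Im c)\<^sup>2) \<in> P" .
    then have "(Re c)\<^sup>2 + (Im c)\<^sup>2 = 0" using unit by blast
    then show False using \<open>c \<noteq> 0\<close> by (simp add: complex_eq_iff sum_power2_eq_zero_iff)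
  qed
  have C_rel: "rel (C r) (of_real r)" for r
    using subidealD(2)[OF P(1)] by (simp add: rel_def val_def)
  have uniq: "c = c'" if "rel z c" "rel z c'" for z c c'
  proof -
    have "rel (z + C (-1) * z) (c + of_real (-1) * c')"
      using that C_rel by (intro add mult)
    then have "c + of_real (-1) * c' = 0"
      using zero subidealD(2)[OF P(1)] by (force simp: hom_uminus)
    then show ?thesis by simp
  qed
  define \<phi> where "\<phi> z = (SOME c. rel z c)" for z
  have \<phi>: "rel z (\<phi> z)" if "z \<in> S" for z
    unfolding \<phi>_def using ex[OF that] by (rule someI_ex)
  have \<phi>_eq: "\<phi> z = c" if "rel z c" for z c
    using uniq[OF \<phi>[of z] that] that by (auto simp: rel_def)
  show thesis
  proof (rule that)
    show "\<phi> (a + b) = \<phi> a + \<phi> b" if "a \<in> S" "b \<in> S" for a b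
      using that by (intro \<phi>_eq add \<phi>)
    show "\<phi> (a * b) = \<phi> a * \<phi> b" if "a \<in> S" "b \<in> S" for a b
      using that by (intro \<phi>_eq mult \<phi>)
    show "\<phi> (C r) = of_real r" for r by (intro \<phi>_eq C_rel)
    show "\<phi> a = 0" if "a \<in> K" for a
      using that P(2) zero \<phi> subidealD(1)[OF K] by blast
    show "\<phi> f \<noteq> 0"
      using \<phi>[OF f(1)] fP[of 1] by (auto simp: rel_def val_def)
  qed
qed

end

section \<open>Evaluation of polynomials\<close>

lemma rpoly_eq_sum_monomials:
  "f = (\<Sum>m\<in>Poly_Mapping.keys f. Poly_Mapping.single m (Poly_Mapping.lookup f m))"
  by (rule poly_mapping_eqI)
    (simp add: lookup_sum lookup_single when_def not_in_keys_iff_lookup_eq_zero)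

definition eval_monom :: "('x \<Rightarrow> 'b::comm_monoid_mult) \<Rightarrow> ('x \<Rightarrow>\<^sub>0 nat) \<Rightarrow> 'b" where
  "eval_monom x m = (\<Prod>i\<in>Poly_Mapping.keys m. x i ^ Poly_Mapping.lookup m i)"

text \<open>Products over the supports of two monomials become comparable over a common finite set;
  exponent 0 contributes the factor 1.\<close>

lemma eval_monom_superset:
  "finite A \<Longrightarrow> Poly_Mapping.keys m \<subseteq> A \<Longrightarrow> eval_monom x m = (\<Prod>i\<in>A. x i ^ Poly_Mapping.lookup m i)"
  unfolding eval_monom_def
  by (rule prod.mono_neutral_left) (auto simp: in_keys_iff)

lemma eval_monom_add: "eval_monom x (m + n) = eval_monom x m * eval_monom x n"
proof -
  let ?A = "Poly_Mapping.keys m \<union> Poly_Mapping.keys n"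
  have "finite ?A" "Poly_Mapping.keys (m + n) \<subseteq> ?A" by (simp_all add: Poly_Mapping.keys_add)
  then show ?thesis
    by (simp add: eval_monom_superset[of ?A] lookup_add power_add prod.distrib)
qed

lemma eval_poly_superset:
  "finite A \<Longrightarrow> Poly_Mapping.keys f \<subseteq> A \<Longrightarrow>
    eval_poly x f = (\<Sum>m\<in>A. of_real (Poly_Mapping.lookup f m) * eval_monom x m)"
  unfolding eval_poly_def eval_monom_def
  by (rule sum.mono_neutral_left) (auto simp: in_keys_iff)

lemma eval_poly_single: "eval_poly x (Poly_Mapping.single m r) = of_real r * eval_monom x m"
  by (subst eval_poly_superset[of "{m}"]) auto

lemma eval_poly_add: "eval_poly x (f + g) = eval_poly x f + eval_poly x g"
proof -
  let ?A = "Poly_Mapping.keys f \<union> Poly_Mapping.keys g"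
  have "finite ?A" "Poly_Mapping.keys (f + g) \<subseteq> ?A" by (simp_all add: Poly_Mapping.keys_add)
  then show ?thesis
    by (simp add: eval_poly_superset[of ?A] lookup_add distrib_right sum.distrib)
qed

lemma eval_poly_sum: "eval_poly x (sum u T) = (\<Sum>t\<in>T. eval_poly x (u t))"
  by (induction T rule: infinite_finite_induct) (simp_all add: eval_poly_add, simp_all add: eval_poly_def)

lemma eval_poly_mult: "eval_poly x (f * g) = eval_poly x f * eval_poly x g"
proof -
  let ?f = "Poly_Mapping.lookup f" and ?g = "Poly_Mapping.lookup g"
  have "f * g = (\<Sum>m\<in>Poly_Mapping.keys f. \<Sum>n\<in>Poly_Mapping.keys g. Poly_Mapping.single (m + n) (?f m * ?g n))"
    by (subst rpoly_eq_sum_monomials[of f], subst rpoly_eq_sum_monomials[of g])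
      (simp add: sum_product mult_single)
  then have "eval_poly x (f * g) = (\<Sum>m\<in>Poly_Mapping.keys f. \<Sum>n\<in>Poly_Mapping.keys g.
      (of_real (?f m) * eval_monom x m) * (of_real (?g n) * eval_monom x n))"
    by (simp add: eval_poly_sum eval_poly_single eval_monom_add mult_ac)
  then show ?thesis
    by (simp add: sum_product eval_poly_superset[of _ f, OF finite_keys order_refl]
      eval_poly_superset[of _ g, OF finite_keys order_refl])
qed

lemma comm_ring_hom_eval_poly: "comm_ring_hom (eval_poly x)"
proof
  show "eval_poly x 0 = 0" by (simp add: eval_poly_def)
  show "eval_poly x 1 = 1"
    using eval_poly_single[of x 0 1] by (simp add: eval_monom_def)
qed (simp_all add: eval_poly_add eval_poly_mult)

lemma eval_poly_Var [simp]: "eval_poly x (Var v) = x v"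
  by (simp add: Var_def eval_poly_single eval_monom_def)

lemma eval_poly_cong:
  assumes "\<And>v. v \<in> vars f \<Longrightarrow> x v = y v"
  shows "eval_poly x f = eval_poly y f"
proof -
  have "x i = y i" if "m \<in> Poly_Mapping.keys f" "i \<in> Poly_Mapping.keys m" for m i
    using that by (intro assms) (auto simp: vars_def)
  then show ?thesis by (simp add: eval_poly_def)
qed

lemma eval_poly_of_real: "eval_poly (\<lambda>v. of_real (x v)) f = of_real (eval_poly x f)"
  by (simp add: eval_poly_def)

text \<open>Reduces vanishing of a generated ideal at a point to vanishing of its generators, by
  minimality.\<close>

lemma ideal_vanishing_polys:
  "ideal {f \<in> carrier (poly_ring X). eval_poly x f = 0} (poly_ring X)"
proof -
  interpret R: cring "poly_ring X" by (rule cring_poly_ring)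
  interpret ev: comm_ring_hom "eval_poly x" by (rule comm_ring_hom_eval_poly)
  have inv: "\<ominus>\<^bsub>poly_ring X\<^esub> f = - f" if "f \<in> carrier (poly_ring X)" for f
    by (rule R.minus_equality) (use that in \<open>auto simp: poly_ring_def\<close>)
  show ?thesis
  proof (rule idealI)
    show "Ring.ring (poly_ring X)" by (rule R.ring_axioms)
    show "subgroup {f \<in> carrier (poly_ring X). eval_poly x f = 0} (add_monoid (poly_ring X))"
    proof (unfold_locales, goal_cases)
      case (4 f)
      then have "inv\<^bsub>add_monoid (poly_ring X)\<^esub> f = - f"
        using inv by (simp add: a_inv_def)
      with 4 show ?case by (simp add: poly_ring_def ev.hom_uminus)
    qed (use vars_add[where 'a='a] in \<open>fastforce simp: poly_ring_def ev.hom_add\<close>)+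
  qed (use vars_mult[where 'a='a] in \<open>fastforce simp: poly_ring_def ev.hom_mult\<close>)+
qed

section \<open>The Nullstellensatz for polynomial rings\<close>

definition const :: "real \<Rightarrow> 'x rpoly" where
  "const r = Poly_Mapping.single 0 r"

lemma const_mult_monomial: "const r * Poly_Mapping.single m s = Poly_Mapping.single m (r * s)"
  by (simp add: const_def mult_single)

text \<open>Lets a ring homomorphism on polynomials be computed from its values on constants and
  variables.\<close>

lemma monomial_eq_prod_Var:
  "Poly_Mapping.single m r = const r * (\<Prod>i\<in>Poly_Mapping.keys m. Var i ^ Poly_Mapping.lookup m i)"
proof -
  have pow: "Var i ^ k = Poly_Mapping.single (Poly_Mapping.single i k) 1" for i :: 'a and k
    by (induction k) (simp_all add: Var_def mult_single flip: single_add)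
  have prod: "(\<Prod>i\<in>A. Poly_Mapping.single (u i) 1) = (Poly_Mapping.single (\<Sum>i\<in>A. u i) 1 :: 'a rpoly)"
    for A :: "'a set" and u
    by (induction A rule: infinite_finite_induct) (simp_all add: mult_single)
  have "m = (\<Sum>i\<in>Poly_Mapping.keys m. Poly_Mapping.single i (Poly_Mapping.lookup m i))"
    by (rule poly_mapping_eqI)
      (simp add: lookup_sum lookup_single when_def not_in_keys_iff_lookup_eq_zero)
  then show ?thesis by (simp add: pow prod const_mult_monomial)
qed

text \<open>A monomial is determined by the graph of its exponents on its support, a finite set of
  pairs from a countable set.\<close>

lemma inj_monomials: "\<exists>h :: ('x::countable \<Rightarrow>\<^sub>0 nat) \<Rightarrow> nat. inj h"
proof -
  let ?graph = "\<lambda>m :: 'x \<Rightarrow>\<^sub>0 nat. (\<lambda>i. (i, Poly_Mapping.lookup m i)) ` Poly_Mapping.keys m"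
  have "inj ?graph"
  proof (rule injI, rule poly_mapping_eqI)
    fix m n :: "'x \<Rightarrow>\<^sub>0 nat" and i assume eq: "?graph m = ?graph n"
    have *: "(i, k) \<in> ?graph m \<longleftrightarrow> k = Poly_Mapping.lookup m i \<and> k \<noteq> 0" for m :: "'x \<Rightarrow>\<^sub>0 nat" and k
      by (auto simp: in_keys_iff)
    show "Poly_Mapping.lookup m i = Poly_Mapping.lookup n i"
      using *[of _ m] *[of _ n] eq by metis
  qed
  moreover have "countable (range ?graph)"
    by (rule countable_subset[OF _ countable_Collect_finite]) auto
  ultimately have "countable (UNIV :: ('x \<Rightarrow>\<^sub>0 nat) set)"
    by (metis countable_image_inj_on)
  then show ?thesis by (auto simp: countable_def)
qed

lemma countable_real_algebra_polys:
  fixes X :: "'x::countable set"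
  shows "countable_real_algebra const {f. vars f \<subseteq> X}"
proof
  fix r s :: real
  show "const (r + s) = (const r + const s :: 'x rpoly)" by (simp add: const_def single_add)
  show "const (r * s) = (const r * const s :: 'x rpoly)" by (simp add: const_def mult_single)
  show "const 1 = (1 :: 'x rpoly)" "const 0 = (0 :: 'x rpoly)" by (simp_all add: const_def)
  show "const r \<in> {f :: 'x rpoly. vars f \<subseteq> X}" by (auto simp: const_def vars_def)
next
  fix f g :: "'x rpoly" assume "f \<in> {f. vars f \<subseteq> X}" "g \<in> {f. vars f \<subseteq> X}"
  then show "f + g \<in> {f. vars f \<subseteq> X}" "f * g \<in> {f. vars f \<subseteq> X}"
    using vars_add[of f g] vars_mult[of f g] by auto
next
  obtain h :: "('x \<Rightarrow>\<^sub>0 nat) \<Rightarrow> nat" where h: "inj h" using inj_monomials by blast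
  let ?e = "\<lambda>k. Poly_Mapping.single (inv_into UNIV h k) (1::real)"
  have "\<exists>d a. g = (\<Sum>k<d. const (a k) * ?e k)" for g :: "'x rpoly"
  proof -
    \<comment> \<open>Coefficient 0 outside the image of the support removes the arbitrary values of
      \<open>inv_into\<close> there.\<close>
    define a where "a k = (if k \<in> h ` Poly_Mapping.keys g then Poly_Mapping.lookup g (inv_into UNIV h k) else 0)" for k
    obtain d where d: "h ` Poly_Mapping.keys g \<subseteq> {..<d}"
      using finite_nat_bounded[of "h ` Poly_Mapping.keys g"] by auto
    have "g = (\<Sum>m\<in>Poly_Mapping.keys g. Poly_Mapping.single m (Poly_Mapping.lookup g m))"
      by (rule rpoly_eq_sum_monomials)
    also have "\<dots> = (\<Sum>k\<in>h ` Poly_Mapping.keys g. const (a k) * ?e k)"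
      using h by (simp add: sum.reindex[OF inj_on_subset[OF h]] const_mult_monomial a_def)
    also have "\<dots> = (\<Sum>k<d. const (a k) * ?e k)"
      using d by (intro sum.mono_neutral_left) (auto simp: a_def const_def)
    finally show ?thesis by blast
  qed
  then show "\<exists>e. \<forall>g\<in>{f :: 'x rpoly. vars f \<subseteq> X}. \<exists>d a. g = (\<Sum>k<d. const (a k) * e (k::nat))"
    by (intro exI[of _ ?e]) blast
qed

text \<open>The homomorphism supplied by the Nullstellensatz is evaluation at the images of the
  variables.\<close>

theorem nullstellensatz_poly_ring:
  fixes X :: "'x::countable set"
  assumes K: "ideal K (poly_ring X)" and f: "f \<in> carrier (poly_ring X)" "\<And>n. f ^ n \<notin> K"
  obtains y :: "'x \<Rightarrow> complex" where "\<And>g. g \<in> K \<Longrightarrow> eval_poly y g = 0" "eval_poly y f \<noteq> 0"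
proof -
  let ?S = "{f :: 'x rpoly. vars f \<subseteq> X}"
  interpret countable_real_algebra const ?S by (rule countable_real_algebra_polys)
  interpret K: ideal K "poly_ring X" by (rule K)
  have "subideal K"
    using K.a_subset additive_subgroup.zero_closed[OF ideal.axioms(1)[OF K]]
      additive_subgroup.a_closed[OF ideal.axioms(1)[OF K]] K.I_l_closed
    by (auto simp: subideal_def poly_ring_def)
  then obtain \<phi> :: "'x rpoly \<Rightarrow> complex" where
    \<phi>_add: "\<And>a b. a \<in> ?S \<Longrightarrow> b \<in> ?S \<Longrightarrow> \<phi> (a + b) = \<phi> a + \<phi> b" and
    \<phi>_mult: "\<And>a b. a \<in> ?S \<Longrightarrow> b \<in> ?S \<Longrightarrow> \<phi> (a * b) = \<phi> a * \<phi> b" and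
    \<phi>_const: "\<And>r. \<phi> (const r) = of_real r" and
    \<phi>: "\<And>a. a \<in> K \<Longrightarrow> \<phi> a = 0" "\<phi> f \<noteq> 0"
    using nullstellensatz[of K f] f by (auto simp: poly_ring_def)
  have \<phi>_01: "\<phi> 0 = 0" "\<phi> 1 = 1" using \<phi>_const[of 0] \<phi>_const[of 1] by simp_all
  have \<phi>_sum: "\<phi> (sum u T) = (\<Sum>t\<in>T. \<phi> (u t))" if "\<And>t. t \<in> T \<Longrightarrow> u t \<in> ?S" for T :: "('x \<Rightarrow>\<^sub>0 nat) set" and u
    using that by (induction T rule: infinite_finite_induct) (simp_all add: \<phi>_01 \<phi>_add[OF _ sum_in])
  have \<phi>_prod: "\<phi> (prod u T) = (\<Prod>t\<in>T. \<phi> (u t))" if "\<And>t. t \<in> T \<Longrightarrow> u t \<in> ?S" for T :: "'x set" and u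
    using that by (induction T rule: infinite_finite_induct) (simp_all add: \<phi>_01 \<phi>_mult[OF _ prod_in])
  have \<phi>_power: "\<phi> (u ^ n) = \<phi> u ^ n" if "u \<in> ?S" for u n
    using that power_in[OF that] by (induction n) (simp_all add: \<phi>_01 \<phi>_mult)
  \<comment> \<open>The values outside \<open>X\<close> are unspecified; polynomials in the ring
    contain variables from \<open>X\<close> only.\<close>
  define y where "y v = \<phi> (Var v)" for v
  have eq: "\<phi> g = eval_poly y g" if "g \<in> ?S" for g
  proof -
    have mon: "(\<Prod>i\<in>Poly_Mapping.keys m. Var i ^ Poly_Mapping.lookup m i) \<in> ?S"
      "\<phi> (\<Prod>i\<in>Poly_Mapping.keys m. Var i ^ Poly_Mapping.lookup m i) = eval_monom y m"
      if m: "m \<in> Poly_Mapping.keys g" for m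
    proof -
      have V: "Var i \<in> ?S" if "i \<in> Poly_Mapping.keys m" for i
      proof -
        have "i \<in> vars g" using that m by (auto simp: vars_def)
        then show ?thesis using \<open>g \<in> ?S\<close> by auto
      qed
      then show "(\<Prod>i\<in>Poly_Mapping.keys m. Var i ^ Poly_Mapping.lookup m i) \<in> ?S"
        by (intro prod_in power_in)
      show "\<phi> (\<Prod>i\<in>Poly_Mapping.keys m. Var i ^ Poly_Mapping.lookup m i) = eval_monom y m"
        unfolding eval_monom_def y_def using V power_in[OF V]
        by (subst \<phi>_prod) (auto intro!: prod.cong \<phi>_power)
    qed
    have "\<phi> g = \<phi> (\<Sum>m\<in>Poly_Mapping.keys g. const (Poly_Mapping.lookup g m) *
        (\<Prod>i\<in>Poly_Mapping.keys m. Var i ^ Poly_Mapping.lookup m i))"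
      by (subst rpoly_eq_sum_monomials[of g]) (simp only: monomial_eq_prod_Var)
    also have "\<dots> = (\<Sum>m\<in>Poly_Mapping.keys g. \<phi> (const (Poly_Mapping.lookup g m) *
        (\<Prod>i\<in>Poly_Mapping.keys m. Var i ^ Poly_Mapping.lookup m i)))"
      by (rule \<phi>_sum) (rule mult_in[OF C_in mon(1)])
    also have "\<dots> = (\<Sum>m\<in>Poly_Mapping.keys g. of_real (Poly_Mapping.lookup g m) * eval_monom y m)"
      by (intro sum.cong refl) (simp only: \<phi>_mult[OF C_in mon(1)] \<phi>_const mon(2))
    finally show ?thesis by (simp add: eval_poly_superset[of _ g, OF finite_keys order_refl])
  qed
  show thesis
  proof (rule that)
    show "eval_poly y g = 0" if "g \<in> K" for g
      using \<phi>(1)[OF that] eq[of g] that K.a_subset by (auto simp: poly_ring_def)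
    show "eval_poly y f \<noteq> 0" using \<phi>(2) eq[of f] f(1) by (auto simp: poly_ring_def)
  qed
qed

section \<open>Minors of the generic symmetric matrix\<close>

definition sym_entry :: "(nat \<times> nat \<Rightarrow> 'a) \<Rightarrow> nat \<Rightarrow> nat \<Rightarrow> 'a" where
  "sym_entry y i j = y (min i j, max i j)"

text \<open>Rows come first, then columns. In contrast to \<open>submatrix\<close>, the indices may
  repeat and come in any order; the same holds for \<open>minor3\<close>.\<close>

definition minor2 :: "(nat \<Rightarrow> nat \<Rightarrow> 'a::comm_ring_1) \<Rightarrow> nat \<Rightarrow> nat \<Rightarrow> nat \<Rightarrow> nat \<Rightarrow> 'a" where
  "minor2 s i j k l = s i k * s j l - s i l * s j k"

definition minor3 ::
    "(nat \<Rightarrow> nat \<Rightarrow> 'a::comm_ring_1) \<Rightarrow> nat \<Rightarrow> nat \<Rightarrow> nat \<Rightarrow> nat \<Rightarrow> nat \<Rightarrow> nat \<Rightarrow> 'a" where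
  "minor3 s i j k l m n =
    s i l * minor2 s j k m n - s i m * minor2 s j k l n + s i n * minor2 s j k l m"

lemma det_mat_2: "det (mat 2 2 u) = u (0, 0) * u (1, 1) - u (0, 1) * u (1, 0)"
  for u :: "nat \<times> nat \<Rightarrow> 'a::comm_ring_1"
  by (subst laplace_expansion_row[of _ 2 0])
    (auto simp: cofactor_def det_single mat_delete_def numeral_2_eq_2)

lemma det_mat_3: "det (mat 3 3 u) =
    u (0, 0) * (u (1, 1) * u (2, 2) - u (1, 2) * u (2, 1))
    - u (0, 1) * (u (1, 0) * u (2, 2) - u (1, 2) * u (2, 0))
    + u (0, 2) * (u (1, 0) * u (2, 1) - u (1, 1) * u (2, 0))"
  for u :: "nat \<times> nat \<Rightarrow> 'a::comm_ring_1"
proof -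
  have "mat_delete (mat 3 3 u) 0 j = mat 2 2 (\<lambda>(a, b). u (Suc a, if b < j then b else Suc b))" for j
    by (rule eq_matI) (auto simp: mat_delete_def)
  then show ?thesis
    by (subst laplace_expansion_row[of _ 3 0])
      (auto simp: cofactor_def det_mat_2[unfolded numeral_2_eq_2] numeral_3_eq_3 numeral_2_eq_2
        algebra_simps)
qed

lemma eval_sigma_minor:
  assumes "A \<subseteq> {..<p}" "B \<subseteq> {..<p}"
  shows "eval_poly y (sigma_minor p A B) =
    det (mat (card A) (card B) (\<lambda>(a, b). sym_entry y (pick A a) (pick B b)))"
proof -
  interpret comm_ring_hom "eval_poly y" by (rule comm_ring_hom_eval_poly)
  have eqs: "{i. i < p \<and> i \<in> A} = A" "{i. i < p \<and> i \<in> B} = B" using assms by auto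
  have fin: "finite A" "finite B" using assms finite_subset by blast+
  have "pick A a < p" if "a < card A" for a
    using pick_in_set_le[OF that] assms(1) by auto
  moreover have "pick B b < p" if "b < card B" for b
    using pick_in_set_le[OF that] assms(2) by auto
  ultimately have "map_mat (eval_poly y) (submatrix (generic_sym_mat p) A B) =
      mat (card A) (card B) (\<lambda>(a, b). sym_entry y (pick A a) (pick B b))"
    by (intro eq_matI) (auto simp: submatrix_def generic_sym_mat_def eqs sym_entry_def)
  then show ?thesis by (metis hom_det)
qed

lemma eval_sigma_minor_1:
  assumes "A \<subseteq> {..<p}" "B \<subseteq> {..<p}" "card A = 1" "card B = 1"
  shows "eval_poly y (sigma_minor p A B) = sym_entry y (pick A 0) (pick B 0)"
  by (subst eval_sigma_minor) (simp_all add: assms det_single)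

lemma eval_sigma_minor_2:
  assumes "A \<subseteq> {..<p}" "B \<subseteq> {..<p}" "card A = 2" "card B = 2"
  shows "eval_poly y (sigma_minor p A B) =
    minor2 (sym_entry y) (pick A 0) (pick A 1) (pick B 0) (pick B 1)"
  by (subst eval_sigma_minor) (simp_all add: assms det_mat_2 minor2_def)

lemma eval_sigma_minor_3:
  assumes "A \<subseteq> {..<p}" "B \<subseteq> {..<p}" "card A = 3" "card B = 3"
  shows "eval_poly y (sigma_minor p A B) =
    minor3 (sym_entry y) (pick A 0) (pick A 1) (pick A 2) (pick B 0) (pick B 1) (pick B 2)"
  by (subst eval_sigma_minor) (simp_all add: assms det_mat_3 minor3_def minor2_def)

lemma pick_singleton: "pick {i} 0 = i"
  by (auto intro: Least_equality)

lemma pick_pair: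
  assumes "i < j"
  shows "pick {i, j} 0 = i" "pick {i, j} 1 = j"
proof -
  show 0: "pick {i, j} 0 = i" using assms by (auto intro!: Least_equality)
  show "pick {i, j} 1 = j" using assms 0 by (auto intro!: Least_equality)
qed

lemma pick_triple:
  assumes "i < j" "j < k"
  shows "pick {i, j, k} 0 = i" "pick {i, j, k} 1 = j" "pick {i, j, k} 2 = k"
proof -
  show 0: "pick {i, j, k} 0 = i" using assms by (auto intro!: Least_equality)
  show 1: "pick {i, j, k} 1 = j" using assms 0 by (auto intro!: Least_equality)
  show "pick {i, j, k} 2 = k"
    using assms 1 by (auto simp: numeral_2_eq_2 intro!: Least_equality)
qed

text \<open>Adjacent transpositions sort any triple. Applied to minors, which are alternating in
  their rows and in their columns.\<close>

lemma all_triples_from_increasing: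
  fixes i j k :: nat
  assumes swap: "\<And>i j k. Q i j k \<Longrightarrow> Q j i k" "\<And>i j k. Q i j k \<Longrightarrow> Q i k j" and diag: "\<And>i j. Q i i j"
    and incr: "\<And>i j k. i < j \<Longrightarrow> j < k \<Longrightarrow> k < p \<Longrightarrow> Q i j k"
    and "i < p" "j < p" "k < p"
  shows "Q i j k"
proof -
  have *: "Q i j k" if "i \<le> j" "j \<le> k" "k < p" for i j k
    using that incr[of i j k] diag[of i k] swap(1)[OF swap(2)[OF diag[of j i]]]
    by (cases "i = j"; cases "j = k") auto
  consider "i \<le> j" "j \<le> k" | "i \<le> k" "k \<le> j" | "j \<le> i" "i \<le> k" | "j \<le> k" "k \<le> i"
    | "k \<le> i" "i \<le> j" | "k \<le> j" "j \<le> i" by linarith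
  then show ?thesis using * swap assms(5-7) by cases metis+
qed

text \<open>The generators list rows and columns in increasing order. Reordering changes only the
  sign, and a repeated index gives 0.\<close>

lemma minors3_vanish:
  fixes y :: "nat \<times> nat \<Rightarrow> 'a::{real_algebra_1, comm_ring_1}"
  assumes van: "\<And>A B. A \<subseteq> {..<p} \<Longrightarrow> B \<subseteq> {..<p} \<Longrightarrow> card A = 3 \<Longrightarrow> card B = 3 \<Longrightarrow>
      eval_poly y (sigma_minor p A B) = 0"
    and "i < p" "j < p" "k < p" "l < p" "m < p" "n < p"
  shows "minor3 (sym_entry y) i j k l m n = 0"
proof -
  let ?M = "minor3 (sym_entry y)"
  have base: "?M i j k l m n = 0" if "i < j" "j < k" "k < p" "l < m" "m < n" "n < p" for i j k l m n
  proof -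
    have *: "{i, j, k} \<subseteq> {..<p}" "{l, m, n} \<subseteq> {..<p}" "card {i, j, k} = 3" "card {l, m, n} = 3"
      using that by auto
    show ?thesis
      using trans[OF eval_sigma_minor_3[OF *, symmetric] van[OF *]]
      by (simp only: pick_triple[OF that(1,2)] pick_triple[OF that(4,5)])
  qed
  have cols: "?M i j k l m n = 0" if ijk: "i < j" "j < k" "k < p" and "l < p" "m < p" "n < p"
    for i j k l m n
    using \<open>l < p\<close> \<open>m < p\<close> \<open>n < p\<close>
  proof (rule all_triples_from_increasing[of "\<lambda>l m n. ?M i j k l m n = 0" p, rotated 4])
    show "?M i j k m l n = 0" if "?M i j k l m n = 0" for l m n
    proof -
      have "?M i j k m l n = - ?M i j k l m n" by (simp add: minor3_def minor2_def algebra_simps)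
      with that show ?thesis by simp
    qed
    show "?M i j k l n m = 0" if "?M i j k l m n = 0" for l m n
    proof -
      have "?M i j k l n m = - ?M i j k l m n" by (simp add: minor3_def minor2_def algebra_simps)
      with that show ?thesis by simp
    qed
    show "?M i j k l l m = 0" for l m by (simp add: minor3_def minor2_def algebra_simps)
  qed (use base[OF ijk] in blast)
  show ?thesis
    using assms(2-4)
  proof (rule all_triples_from_increasing[of "\<lambda>i j k. ?M i j k l m n = 0" p, rotated 4])
    show "?M j i k l m n = 0" if "?M i j k l m n = 0" for i j k
    proof -
      have "?M j i k l m n = - ?M i j k l m n" by (simp add: minor3_def minor2_def algebra_simps)
      with that show ?thesis by simp
    qed
    show "?M i k j l m n = 0" if "?M i j k l m n = 0" for i j k
    proof -
      have "?M i k j l m n = - ?M i j k l m n" by (simp add: minor3_def minor2_def algebra_simps)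
      with that show ?thesis by simp
    qed
    show "?M i i j l m n = 0" for i j by (simp add: minor3_def minor2_def algebra_simps)
  qed (use cols assms(5-7) in blast)
qed

lemma minor2_vanish:
  fixes y :: "nat \<times> nat \<Rightarrow> 'a::{real_algebra_1, comm_ring_1}"
  assumes van: "i \<noteq> j \<Longrightarrow> k \<noteq> l \<Longrightarrow> eval_poly y (sigma_minor p {i, j} {k, l}) = 0"
    and "i < p" "j < p" "k < p" "l < p"
  shows "minor2 (sym_entry y) i j k l = 0"
proof (cases "i = j \<or> k = l")
  case True
  then show ?thesis by (auto simp: minor2_def)
next
  case False
  define i' j' k' l' where "i' = min i j" "j' = max i j" "k' = min k l" "l' = max k l"
  note defs = this
  have less: "i' < j'" "k' < l'" and eqs: "{i', j'} = {i, j}" "{k', l'} = {k, l}"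
    using False by (auto simp: defs min_def max_def)
  have *: "{i', j'} \<subseteq> {..<p}" "{k', l'} \<subseteq> {..<p}" "card {i', j'} = 2" "card {k', l'} = 2"
    using False assms(2-) by (auto simp: eqs)
  have "eval_poly y (sigma_minor p {i', j'} {k', l'}) = 0" using van False by (simp add: eqs)
  from trans[OF eval_sigma_minor_2[OF *, symmetric] this]
  have "minor2 (sym_entry y) i' j' k' l' = 0"
    by (simp only: pick_pair[OF less(1)] pick_pair[OF less(2)])
  then show ?thesis
    by (auto simp: defs minor2_def min_def max_def algebra_simps split: if_splits)
qed

section \<open>Complex symmetric matrices of rank at most two\<close>

lemma complex_gram_2x2:
  fixes p q r :: complex
  shows "\<exists>a b c e. a\<^sup>2 + b\<^sup>2 = p \<and> a * c + b * e = q \<and> c\<^sup>2 + e\<^sup>2 = r"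
proof -
  have *: "\<exists>a b c e. a\<^sup>2 + b\<^sup>2 = p \<and> a * c + b * e = q \<and> c\<^sup>2 + e\<^sup>2 = r" if "p \<noteq> 0" for p q r :: complex
  proof -
    \<comment> \<open>Cholesky factorization, with complex square roots.\<close>
    have "(csqrt p)\<^sup>2 + 0\<^sup>2 = p \<and> csqrt p * (q / csqrt p) + 0 * csqrt (r - q\<^sup>2 / p) = q \<and>
        (q / csqrt p)\<^sup>2 + (csqrt (r - q\<^sup>2 / p))\<^sup>2 = r"
      using that by (simp add: power_divide)
    then show ?thesis by blast
  qed
  show ?thesis
  proof (cases "p = 0 \<and> r = 0")
    case True
    \<comment> \<open>Two isotropic vectors, scaled to have product \<open>q\<close>.\<close>
    then have "1\<^sup>2 + \<i>\<^sup>2 = p \<and> 1 * (q / 2) + \<i> * (- \<i> * q / 2) = q \<and> (q / 2)\<^sup>2 + (- \<i> * q / 2)\<^sup>2 = r"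
      by (simp add: power_mult_distrib power_divide flip: mult.assoc)
    then show ?thesis by blast
  next
    case False
    then show ?thesis
    proof (cases "p = 0")
      case True
      with False obtain a b c e where "a\<^sup>2 + b\<^sup>2 = r" "a * c + b * e = q" "c\<^sup>2 + e\<^sup>2 = p"
        using *[of r q p] by blast
      then show ?thesis
        by (intro exI[of _ c] exI[of _ e] exI[of _ a] exI[of _ b]) (simp add: mult.commute)
    qed (rule *)
  qed
qed

text \<open>If some principal 2x2 minor is nonzero, a Gram representation of that block extends to
  all rows; otherwise the rank is at most one. Case \<open>two\<close> keeps the independence of two
  of the vectors, which allows cancellation later.\<close>

lemma complex_symmetric_rank_le_2:
  fixes s :: "nat \<Rightarrow> nat \<Rightarrow> complex"
  assumes sym: "\<And>i j. s i j = s j i"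
    and minors: "\<And>i j k l m n. i < p \<Longrightarrow> j < p \<Longrightarrow> k < p \<Longrightarrow> l < p \<Longrightarrow> m < p \<Longrightarrow> n < p \<Longrightarrow>
      minor3 s i j k l m n = 0"
  obtains (one) m where "\<And>i j. i < p \<Longrightarrow> j < p \<Longrightarrow> s i j = m i * m j"
    | (two) k l m n where "k < p" "l < p" "m k * n l - m l * n k \<noteq> 0"
      "\<And>i j. i < p \<Longrightarrow> j < p \<Longrightarrow> s i j = m i * m j + n i * n j"
proof -
  consider k l where "k < p" "l < p" "s k k * s l l - s k l * s k l \<noteq> 0"
    | "\<And>k l. k < p \<Longrightarrow> l < p \<Longrightarrow> s k k * s l l = s k l * s k l" by force
  then show thesis
  proof cases
    case (1 k l)
    define d where "d = s k k * s l l - s k l * s k l"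
    have d: "d \<noteq> 0" using 1 by (simp add: d_def)
    obtain a b c e where gram: "a\<^sup>2 + b\<^sup>2 = s k k" "a * c + b * e = s k l" "c\<^sup>2 + e\<^sup>2 = s l l"
      using complex_gram_2x2 by metis
    \<comment> \<open>Cramer's rule: \<open>\<alpha> i\<close> and \<open>\<beta> i\<close> express
      row \<open>i\<close> through rows \<open>k\<close> and \<open>l\<close>, in columns
      \<open>k\<close> and \<open>l\<close>.\<close>
    define \<alpha> where "\<alpha> i = (s i k * s l l - s i l * s k l) / d" for i
    define \<beta> where "\<beta> i = (s i l * s k k - s i k * s k l) / d" for i
    define m where "m i = \<alpha> i * a + \<beta> i * c" for i
    define n where "n i = \<alpha> i * b + \<beta> i * e" for i
    have ik: "\<alpha> i * s k k + \<beta> i * s k l = s i k" and il: "\<alpha> i * s k l + \<beta> i * s l l = s i l" for i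
    proof -
      have "\<alpha> i * s k k + \<beta> i * s k l = s i k * d / d" "\<alpha> i * s k l + \<beta> i * s l l = s i l * d / d"
        unfolding \<alpha>_def \<beta>_def by (simp_all add: d_def add_divide_distrib [symmetric] algebra_simps)
      then show "\<alpha> i * s k k + \<beta> i * s k l = s i k" "\<alpha> i * s k l + \<beta> i * s l l = s i l"
        using d by simp_all
    qed
    have "\<alpha> k = 1" "\<beta> k = 0" "\<alpha> l = 0" "\<beta> l = 1"
      using d by (simp_all add: \<alpha>_def \<beta>_def d_def sym[of l k] mult.commute)
    then have "m k = a" "n k = b" "m l = c" "n l = e" by (simp_all add: m_def n_def)
    moreover have "(a * e - c * b)\<^sup>2 = d"
      unfolding d_def gram[symmetric] by (simp add: power2_eq_square algebra_simps)
    ultimately have "m k * n l - m l * n k \<noteq> 0" using d by auto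
    moreover have "s i j = m i * m j + n i * n j" if "i < p" "j < p" for i j
    proof -
      have "m i * m j + n i * n j =
          \<alpha> j * (\<alpha> i * s k k + \<beta> i * s k l) + \<beta> j * (\<alpha> i * s k l + \<beta> i * s l l)"
        unfolding m_def n_def gram[symmetric] by (simp add: power2_eq_square algebra_simps)
      also have "\<dots> = \<alpha> j * s i k + \<beta> j * s i l" by (simp only: ik il)
      also have "\<dots> = ((s j k * s l l - s j l * s k l) * s i k + (s j l * s k k - s j k * s k l) * s i l) / d"
        by (simp add: \<alpha>_def \<beta>_def add_divide_distrib)
      \<comment> \<open>Expansion of the minor that borders the block by row \<open>i\<close> and
        column \<open>j\<close>; its vanishing determines \<open>s i j\<close>.\<close>
      also have "(s j k * s l l - s j l * s k l) * s i k + (s j l * s k k - s j k * s k l) * s i l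
          = s i j * d - minor3 s i k l j k l"
        by (simp add: minor3_def minor2_def d_def sym[of l k] sym[of k j] sym[of l j] algebra_simps)
      also have "\<dots> = s i j * d" using minors 1 that by simp
      finally show ?thesis using d by simp
    qed
    ultimately show thesis using two 1 by blast
  next
    case 2
    show thesis
    proof (cases "\<exists>k<p. s k k \<noteq> 0")
      case True
      then obtain k where k: "k < p" "s k k \<noteq> 0" by blast
      have "s i j = (s i k / csqrt (s k k)) * (s j k / csqrt (s k k))" if ij: "i < p" "j < p" for i j
      proof -
        \<comment> \<open>The Desnanot-Jacobi identity for the principal minor on \<open>i\<close>,
          \<open>j\<close>, \<open>k\<close>.\<close>
        have "(s i j * s k k - s i k * s j k)\<^sup>2 = 
            (s i i * s k k - s i k * s i k) * (s j j * s k k - s j k * s j k)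
              - s k k * minor3 s i j k i j k"
          by (simp add: minor3_def minor2_def sym[of k i] sym[of k j] sym[of j i] power2_eq_square algebra_simps)
        also have "\<dots> = 0" using minors[of i j k i j k] 2[of i k] k ij by simp
        finally have "s i j * s k k = s i k * s j k" by simp
        then have "s i j = s i k * s j k / s k k" using k by (simp add: field_simps)
        also have "\<dots> = s i k * s j k / (csqrt (s k k))\<^sup>2" by simp
        finally show ?thesis by (simp add: power2_eq_square)
      qed
      then show thesis by (rule one)
    next
      case False
      then have "s i j = 0 * 0" if "i < p" "j < p" for i j using 2[of i j] that by auto
      then show thesis by (rule one)
    qed
  qed
qed

section \<open>Loadings along two orthogonal lines\<close>

text \<open>The predicates \<open>P\<close> and \<open>Q\<close> tell whether a node is a child of the first and of the second latent
  node. The loading vectors of the nodes with only one parent lie on the line through \<open>(a, b)\<close>, or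
  on its orthogonal complement, instead of on a coordinate axis.\<close>

definition loading1 ::
    "(nat \<Rightarrow> bool) \<Rightarrow> (nat \<Rightarrow> bool) \<Rightarrow> 'a \<Rightarrow> 'a \<Rightarrow> (nat \<Rightarrow> 'a) \<Rightarrow> nat \<Rightarrow> 'a::comm_ring_1" where
  "loading1 P Q a b x v = (if P v then if Q v then x v else x v * a else if Q v then - (x v * b) else 0)"

definition loading2 ::
    "(nat \<Rightarrow> bool) \<Rightarrow> (nat \<Rightarrow> bool) \<Rightarrow> 'a \<Rightarrow> 'a \<Rightarrow> (nat \<Rightarrow> 'a) \<Rightarrow> (nat \<Rightarrow> 'a) \<Rightarrow> nat \<Rightarrow> 'a::comm_ring_1" where
  "loading2 P Q a b x y v = (if P v then if Q v then y v else x v * b else if Q v then x v * a else 0)"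

text \<open>Has the form of an assignment to the variables, ready for \<open>eval_poly\<close>. For
  a node with one parent \<open>x v\<close> is the factor along its line; for a node with two
  parents \<open>x v\<close> and \<open>y v\<close> are the coordinates.\<close>

definition gram ::
    "(nat \<Rightarrow> bool) \<Rightarrow> (nat \<Rightarrow> bool) \<Rightarrow> 'a \<Rightarrow> 'a \<Rightarrow> (nat \<Rightarrow> 'a) \<Rightarrow> (nat \<Rightarrow> 'a) \<Rightarrow> nat \<times> nat \<Rightarrow> 'a::comm_ring_1"
  where "gram P Q a b x y = (\<lambda>(i, j). loading1 P Q a b x i * loading1 P Q a b x j +
      loading2 P Q a b x y i * loading2 P Q a b x y j)"

lemma of_real_gram:
  "gram P Q (of_real a) (of_real b) (\<lambda>v. of_real (x v)) (\<lambda>v. of_real (y v)) ij =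
    (of_real (gram P Q a b x y ij) :: complex)"
  by (cases ij) (simp add: gram_def loading1_def loading2_def)

lemma poly_gram:
  "poly (gram P Q a b x y ij) t =
    gram P Q (poly a t) (poly b t) (\<lambda>v. poly (x v) t) (\<lambda>v. poly (y v) t) ij"
  by (cases ij) (simp add: gram_def loading1_def loading2_def)

text \<open>Reduces vanishing at a point to counting the roots of a univariate polynomial.\<close>

lemma eval_poly_along_curve:
  fixes q :: "'x \<Rightarrow> complex poly"
  shows "\<exists>r. \<forall>t. eval_poly (\<lambda>v. poly (q v) t) f = poly r t"
proof -
  let ?r = "\<Sum>m\<in>Poly_Mapping.keys f. Polynomial.smult (of_real (Poly_Mapping.lookup f m))
    (\<Prod>i\<in>Poly_Mapping.keys m. q i ^ Poly_Mapping.lookup m i)"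
  have "eval_poly (\<lambda>v. poly (q v) t) f = poly ?r t" for t
    by (simp add: eval_poly_def poly_sum poly_prod)
  then show ?thesis by blast
qed

text \<open>Joining a complex point \<open>u + \<i> w\<close> to its real part by the line \<open>u + t w\<close> gives a univariate
  polynomial that vanishes for all real \<open>t\<close>, hence for \<open>t = \<i>\<close>.\<close>

lemma gram_vanish_complex:
  fixes a b :: complex
  assumes "\<And>(a::real) b x y. eval_poly (gram P Q a b x y) f = 0"
  shows "eval_poly (gram P Q a b x y) f = 0"
proof -
  define line :: "complex \<Rightarrow> complex poly" where "line c = [:of_real (Re c), of_real (Im c):]" for c
  have line_i: "poly (line c) \<i> = c" for c
    by (simp add: line_def complex_eq_iff)
  have line_real: "poly (line c) (of_real t) = of_real (Re c + t * Im c)" for c t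
    by (simp add: line_def)
  obtain r where r: "\<And>t. eval_poly (\<lambda>ij. poly (gram P Q (line a) (line b) (\<lambda>v. line (x v)) (\<lambda>v. line (y v)) ij) t) f
      = poly r t"
    using eval_poly_along_curve by metis
  have "poly r (of_real t) = 0" for t
    unfolding r[symmetric] poly_gram line_real of_real_gram eval_poly_of_real assms by simp
  then have "range (of_real :: real \<Rightarrow> complex) \<subseteq> {t. poly r t = 0}" by auto
  moreover have "infinite (range (of_real :: real \<Rightarrow> complex))"
    using finite_imageD[of "of_real :: real \<Rightarrow> complex" UNIV] infinite_UNIV_char_0
    by (auto simp: inj_of_real)
  ultimately have "r = 0" using poly_roots_finite finite_subset by blast
  then show ?thesis using r[of \<i>] by (simp add: poly_gram line_i)
qed

text \<open>In rank two, vectors of nodes with the same single parent are parallel by the 2x2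
  minors, and those with different single parents are orthogonal by the entries that vanish. A
  nonzero such vector fixes the direction (a, b).\<close>

lemma gram_parametrization:
  fixes s :: "nat \<Rightarrow> nat \<Rightarrow> complex"
  assumes sym: "\<And>i j. s i j = s j i"
    and minors: "\<And>i j k l m n. i < p \<Longrightarrow> j < p \<Longrightarrow> k < p \<Longrightarrow> l < p \<Longrightarrow> m < p \<Longrightarrow> n < p \<Longrightarrow>
      minor3 s i j k l m n = 0"
    and disjoint: "\<And>i j. i < p \<Longrightarrow> j < p \<Longrightarrow> \<not> (P i \<and> P j) \<Longrightarrow> \<not> (Q i \<and> Q j) \<Longrightarrow> s i j = 0"
    and single1: "\<And>i j k l. i < p \<Longrightarrow> j < p \<Longrightarrow> k < p \<Longrightarrow> l < p \<Longrightarrow> \<not> Q i \<Longrightarrow> \<not> Q j \<Longrightarrow>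
      minor2 s i j k l = 0"
    and single2: "\<And>i j k l. i < p \<Longrightarrow> j < p \<Longrightarrow> k < p \<Longrightarrow> l < p \<Longrightarrow> \<not> P i \<Longrightarrow> \<not> P j \<Longrightarrow>
      minor2 s i j k l = 0"
  shows "\<exists>a b x y. \<forall>i<p. \<forall>j<p. s i j = gram P Q a b x y (i, j)"
proof -
  have from_vectors: ?thesis
    if gram: "\<And>i j. i < p \<Longrightarrow> j < p \<Longrightarrow> s i j = m i * m j + n i * n j"
      and V1: "\<And>v. v < p \<Longrightarrow> P v \<Longrightarrow> \<not> Q v \<Longrightarrow> \<exists>x. m v = x * a \<and> n v = x * b"
      and V2: "\<And>v. v < p \<Longrightarrow> \<not> P v \<Longrightarrow> Q v \<Longrightarrow> \<exists>x. m v = - (x * b) \<and> n v = x * a"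
      and V0: "\<And>v. v < p \<Longrightarrow> \<not> P v \<Longrightarrow> \<not> Q v \<Longrightarrow> m v = 0 \<and> n v = 0" for m n a b
  proof -
    have "\<exists>x. v < p \<longrightarrow> m v = loading1 P Q a b (\<lambda>_. x) v \<and> n v = loading2 P Q a b (\<lambda>_. x) n v" for v
      using V1[of v] V2[of v] V0[of v] unfolding loading1_def loading2_def by (cases "P v"; cases "Q v") auto
    then obtain x where "\<And>v. v < p \<Longrightarrow>
        m v = loading1 P Q a b (\<lambda>_. x v) v \<and> n v = loading2 P Q a b (\<lambda>_. x v) n v" by metis
    then have "m v = loading1 P Q a b x v \<and> n v = loading2 P Q a b x n v" if "v < p" for v
      using that by (simp add: loading1_def loading2_def)
    then have "\<forall>i<p. \<forall>j<p. s i j = gram P Q a b x n (i, j)"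
      by (simp add: gram gram_def)
    then show ?thesis by blast
  qed
  show ?thesis
  proof (rule complex_symmetric_rank_le_2[of s p])
    show "s i j = s j i" for i j by (rule sym)
    show "minor3 s i j k l m n = 0" if "i < p" "j < p" "k < p" "l < p" "m < p" "n < p" for i j k l m n
      using that by (rule minors)
  next
    fix m assume one: "\<And>i j. i < p \<Longrightarrow> j < p \<Longrightarrow> s i j = m i * m j"
    have V0: "m v = 0" if "v < p" "\<not> P v" "\<not> Q v" for v
      using disjoint[of v v] one[of v v] that by simp
    show ?thesis
    \<comment> \<open>In rank one all vectors are put on one coordinate axis: the second, if a node
      with only the second parent is nonzero, since nodes with only the first parent then vanish;
      the first otherwise.\<close>
    proof (cases "\<exists>v<p. \<not> P v \<and> Q v \<and> m v \<noteq> 0")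
      case True
      then obtain v where v: "v < p" "\<not> P v" "Q v" "m v \<noteq> 0" by blast
      have V1: "m w = 0" if "w < p" "P w" "\<not> Q w" for w
        using disjoint[of v w] one[of v w] v that by simp
      show ?thesis
        by (rule from_vectors[of "\<lambda>_. 0" m 1 0]) (use one V0 V1 in auto)
    next
      case False
      show ?thesis
        by (rule from_vectors[of m "\<lambda>_. 0" 1 0]) (use one V0 False in auto)
    qed
  next
    fix k l m n assume kl: "k < p" "l < p" and indep: "m k * n l - m l * n k \<noteq> 0"
      and gram: "\<And>i j. i < p \<Longrightarrow> j < p \<Longrightarrow> s i j = m i * m j + n i * n j"
    have parallel: "m v * n w = m w * n v" if "minor2 s v w k l = 0" "v < p" "w < p" for v w
    proof -
      \<comment> \<open>A minor of a Gram matrix of vectors in the plane is a product of two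
        determinants.\<close>
      have "minor2 s v w k l = (m v * n w - m w * n v) * (m k * n l - m l * n k)"
        using kl that by (simp add: minor2_def gram algebra_simps)
      with that indep show ?thesis by simp
    qed
    have V0: "m v = 0 \<and> n v = 0" if "v < p" "\<not> P v" "\<not> Q v" for v
    proof -
      have zero: "m v * m k + n v * n k = 0" "m v * m l + n v * n l = 0"
        using disjoint[of v k] disjoint[of v l] kl that by (simp_all add: gram)
      \<comment> \<open>Cramer's rule: a vector orthogonal to the independent vectors of
        \<open>k\<close> and \<open>l\<close> is zero.\<close>
      have "m v * (m k * n l - m l * n k) =
          n l * (m v * m k + n v * n k) - n k * (m v * m l + n v * n l)"
        "n v * (m k * n l - m l * n k) =
          m k * (m v * m l + n v * n l) - m l * (m v * m k + n v * n k)"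
        by (simp_all add: algebra_simps)
      then show ?thesis using indep unfolding zero by simp
    qed
    have V12: "m v * m w + n v * n w = 0" if "v < p" "w < p" "\<not> Q v" "\<not> P w" for v w
      using disjoint[of v w] gram[of v w] that by simp
    have line: "\<exists>x. m w = x * c \<and> n w = x * d" if "m w * d = c * n w" "c \<noteq> 0 \<or> d \<noteq> 0" for w c d
    proof (cases "c = 0")
      case True
      then show ?thesis using that by (intro exI[of _ "n w / d"]) auto
    next
      case False
      then show ?thesis using that by (intro exI[of _ "m w / c"]) (auto simp: field_simps)
    qed
    show ?thesis
    proof (cases "\<exists>v<p. P v \<and> \<not> Q v \<and> (m v \<noteq> 0 \<or> n v \<noteq> 0)")
      case True
      then obtain v where v: "v < p" "P v" "\<not> Q v" "m v \<noteq> 0 \<or> n v \<noteq> 0" by blast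
      show ?thesis
      proof (rule from_vectors[of m n "m v" "n v"])
        show "\<exists>x. m w = x * m v \<and> n w = x * n v" if "w < p" "P w" "\<not> Q w" for w
          using parallel[OF single1, of w v] kl v that by (intro line) auto
        show "\<exists>x. m w = - (x * n v) \<and> n w = x * m v" if "w < p" "\<not> P w" "Q w" for w
        proof -
          \<comment> \<open>The orthogonal complement of a nonzero vector of the plane is a line,
            even if the vector is isotropic.\<close>
          have "m w * m v = - n v * n w" using V12[of v w] v that by (simp add: algebra_simps eq_neg_iff_add_eq_0)
          then show ?thesis using line[of w "m v" "- n v"] v(4) by auto
        qed
      qed (use gram V0 in auto)
    next
      case False
      then have V1: "m w = 0 \<and> n w = 0" if "w < p" "P w" "\<not> Q w" for w using that by blast
      show ?thesis
      proof (cases "\<exists>v<p. \<not> P v \<and> Q v \<and> (m v \<noteq> 0 \<or> n v \<noteq> 0)")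
        case True
        then obtain v where v: "v < p" "\<not> P v" "Q v" "m v \<noteq> 0 \<or> n v \<noteq> 0" by blast
        show ?thesis
        \<comment> \<open>Chosen so that the orthogonal direction (-b, a) is the vector of
          \<open>v\<close>.\<close>
        proof (rule from_vectors[of m n "n v" "- m v"])
          show "\<exists>x. m w = - (x * - m v) \<and> n w = x * n v" if "w < p" "\<not> P w" "Q w" for w
            using parallel[OF single2, of w v] kl v that line[of w "n v" "m v"] by auto
        qed (use gram V0 V1 in auto)
      next
        case False
        show ?thesis
          by (rule from_vectors[of m n 1 0]) (use gram V0 V1 False in auto)
      qed
    qed
  qed
qed

section \<open>Models with two latent nodes\<close>

context
  fixes G :: "'h fa_graph" and h1 h2 :: 'h
  assumes latent: "latent G = {h1, h2}" "h1 \<noteq> h2"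
begin

abbreviation "child h v \<equiv> (h, v) \<in> edges G"

lemma in_parents:
  "h1 \<in> parents G A \<longleftrightarrow> (\<exists>v\<in>A. child h1 v)" "h2 \<in> parents G A \<longleftrightarrow> (\<exists>v\<in>A. child h2 v)"
  "parents G A \<subseteq> {h1, h2}"
  by (auto simp: parents_def latent)

text \<open>The identity matrix serves as the diagonal part; it leaves the off-diagonal entries
  unchanged.\<close>

lemma invariants_vanish_at_loadings:
  assumes L: "L \<in> fa_loadings G" and f: "f \<in> invariants G"
  shows "eval_poly (\<lambda>(i, j). \<Sum>h\<in>latent G. L i h * L j h) f = 0"
proof -
  let ?p = "num_obs G"
  let ?S = "1\<^sub>m ?p + mat ?p ?p (\<lambda>(i, j). \<Sum>h\<in>latent G. L i h * L j h)"
  have "?S \<in> fa_model G"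
    using L unfolding fa_model_def Let_def by (force simp: diagonal_mat_def)
  then have "eval_poly (\<lambda>ij. ?S $$ ij) f = 0" using f by (simp add: invariants_def)
  moreover have "vars f \<subseteq> offdiag_vars ?p" using f by (simp add: invariants_def poly_ring_def)
  then have "eval_poly (\<lambda>(i, j). \<Sum>h\<in>latent G. L i h * L j h) f = eval_poly (\<lambda>ij. ?S $$ ij) f"
    by (intro eval_poly_cong) (auto simp: offdiag_vars_def)
  ultimately show ?thesis by simp
qed

text \<open>Rotating \<open>(a, b)\<close> to the first coordinate axis turns these loadings into loadings of the model.\<close>

lemma invariants_vanish_at_gram:
  fixes a b :: real
  assumes f: "f \<in> invariants G"
  shows "eval_poly (gram (child h1) (child h2) a b x y) f = 0"
proof -
  let ?l1 = "loading1 (child h1) (child h2) a b x" and ?l2 = "loading2 (child h1) (child h2) a b x y"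
  have "\<exists>L\<in>fa_loadings G. \<forall>i j. (\<Sum>h\<in>latent G. L i h * L j h) = ?l1 i * ?l1 j + ?l2 i * ?l2 j"
  proof (cases "a = 0 \<and> b = 0")
    case True
    then show ?thesis
      by (intro bexI[of _ "\<lambda>v h. if h = h1 then ?l1 v else ?l2 v"])
        (use latent(2) in \<open>auto simp: fa_loadings_def latent(1) loading1_def loading2_def\<close>)
  next
    case False
    define r where "r = sqrt (a\<^sup>2 + b\<^sup>2)"
    have r: "r * r = a\<^sup>2 + b\<^sup>2" "a\<^sup>2 + b\<^sup>2 \<noteq> 0"
      using False by (simp_all add: r_def sum_power2_eq_zero_iff)
    \<comment> \<open>The coordinates after the rotation. Over the reals a nonzero (a, b) has
      nonzero length, so this division is possible.\<close>
    define L where "L v h = (if h = h1 then ?l1 v * a + ?l2 v * b else ?l2 v * a - ?l1 v * b) / r" for v h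
    have "(\<Sum>h\<in>latent G. L i h * L j h) = ?l1 i * ?l1 j + ?l2 i * ?l2 j" for i j
    proof -
      have "(\<Sum>h\<in>latent G. L i h * L j h) =
          ((?l1 i * a + ?l2 i * b) * (?l1 j * a + ?l2 j * b) +
            (?l2 i * a - ?l1 i * b) * (?l2 j * a - ?l1 j * b)) / (r * r)"
        using latent(2) by (simp add: latent(1) L_def add_divide_distrib)
      also have "\<dots> = (?l1 i * ?l1 j + ?l2 i * ?l2 j) * (a\<^sup>2 + b\<^sup>2) / (a\<^sup>2 + b\<^sup>2)"
        unfolding r by (rule arg_cong2[of _ _ _ _ "(/)"]) (simp_all add: power2_eq_square algebra_simps)
      finally show ?thesis by (simp only: nonzero_mult_div_cancel_right[OF r(2)])
    qed
    moreover have "L \<in> fa_loadings G"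
      using latent(2) by (auto simp: fa_loadings_def latent(1) L_def loading1_def loading2_def)
    ultimately show ?thesis by blast
  qed
  then obtain L where "L \<in> fa_loadings G"
    "\<And>i j. (\<Sum>h\<in>latent G. L i h * L j h) = ?l1 i * ?l1 j + ?l2 i * ?l2 j" by blast
  with invariants_vanish_at_loadings[OF _ f, of L] show ?thesis by (simp add: gram_def)
qed

section \<open>The elimination ideal and its variety\<close>

abbreviation "elimination_source \<equiv>
  minors3_ideal (num_obs G) <+>\<^bsub>poly_ring (sym_vars (num_obs G))\<^esub> separation_ideal G"

lemma minors_subset_carrier:
  "{sigma_minor p A B | A B. A \<subseteq> {..<p} \<and> B \<subseteq> {..<p} \<and> R A B} \<subseteq> carrier (poly_ring (sym_vars p))"
  using sigma_minor_carrier by blast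

lemma sigma_minor_in_genideal:
  assumes "A \<subseteq> {..<p}" "B \<subseteq> {..<p}" "R A B"
  shows "sigma_minor p A B \<in> genideal (poly_ring (sym_vars p))
    {sigma_minor p A B | A B. A \<subseteq> {..<p} \<and> B \<subseteq> {..<p} \<and> R A B}"
proof -
  let ?M = "{sigma_minor p A B | A B. A \<subseteq> {..<p} \<and> B \<subseteq> {..<p} \<and> R A B}"
  have "sigma_minor p A B \<in> ?M" using assms by blast
  moreover have "?M \<subseteq> genideal (poly_ring (sym_vars p)) ?M"
    by (rule ring.genideal_self[OF cring.axioms(1)[OF cring_poly_ring] minors_subset_carrier])
  ultimately show ?thesis by (rule rev_subsetD)
qed

lemma ideal_minors3: "ideal (minors3_ideal p) (poly_ring (sym_vars p))"
  unfolding minors3_ideal_def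
  by (intro ring.genideal_ideal cring.axioms(1) cring_poly_ring minors_subset_carrier)

lemma ideal_separation: "ideal (separation_ideal G) (poly_ring (sym_vars (num_obs G)))"
  unfolding separation_ideal_def Let_def
  by (intro ring.genideal_ideal cring.axioms(1) cring_poly_ring minors_subset_carrier)

lemma ideal_elimination_source: "ideal elimination_source (poly_ring (sym_vars (num_obs G)))"
  by (intro ring.add_ideals cring.axioms(1) cring_poly_ring ideal_minors3 ideal_separation)

text \<open>Rank at most two kills the 3x3 minors. If \<open>H\<close> separates \<open>A\<close>
  and \<open>B\<close>, only latent nodes in \<open>H\<close> contribute to their block, so its rank
  is below \<open>card A\<close>. The minors may meet the diagonal, so the point is the product of
  the loadings without a positive diagonal part.\<close>

lemma elimination_source_vanishes_at_loadings:
  assumes L: "L \<in> fa_loadings G" and f: "f \<in> elimination_source"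
  shows "eval_poly (\<lambda>(i, j). \<Sum>h\<in>latent G. L i h * L j h) f = 0"
proof -
  let ?p = "num_obs G" and ?y = "\<lambda>(i, j). \<Sum>h\<in>latent G. L i h * L j h"
  let ?R = "poly_ring (sym_vars ?p)"
  let ?I = "{f \<in> carrier ?R. eval_poly ?y f = 0}"
  have entry: "sym_entry ?y i j = L i h1 * L j h1 + L i h2 * L j h2" for i j
    using latent(2) by (simp add: sym_entry_def latent(1) min_def max_def mult.commute)
  have L0: "\<not> child h1 v \<Longrightarrow> L v h1 = 0" "\<not> child h2 v \<Longrightarrow> L v h2 = 0" if "v < ?p" for v
    using L that by (auto simp: fa_loadings_def latent)
  have "eval_poly ?y (sigma_minor ?p A B) = 0"
    if "A \<subseteq> {..<?p}" "B \<subseteq> {..<?p}" "card A = 3" "card B = 3" for A B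
    unfolding eval_sigma_minor_3[OF that] minor3_def minor2_def entry by (simp add: algebra_simps)
  then have "minors3_ideal ?p \<subseteq> ?I"
    unfolding minors3_ideal_def
    by (intro ring.genideal_minimal[OF cring.axioms(1)[OF cring_poly_ring] ideal_vanishing_polys])
      (auto simp: sigma_minor_carrier)
  moreover have "eval_poly ?y (sigma_minor ?p A B) = 0"
    if AB: "A \<subseteq> {..<?p}" "B \<subseteq> {..<?p}" "card A = card B" "card A \<le> 2"
      and H: "H \<subseteq> latent G" "card H < card A" "separates G H A B" for A B H
  proof -
    have sep: "h1 \<notin> H \<Longrightarrow> \<not> (\<exists>v\<in>A. child h1 v) \<or> \<not> (\<exists>v\<in>B. child h1 v)"
      "h2 \<notin> H \<Longrightarrow> \<not> (\<exists>v\<in>A. child h2 v) \<or> \<not> (\<exists>v\<in>B. child h2 v)"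
      using H(3) in_parents[of A] in_parents[of B] by (auto simp: separates_def)
    have prod0: "h1 \<notin> H \<Longrightarrow> L i h1 * L j h1 = 0" "h2 \<notin> H \<Longrightarrow> L i h2 * L j h2 = 0"
      if "i \<in> A" "j \<in> B" for i j
      using sep that AB(1,2) L0[of i] L0[of j] by (auto dest: subsetD)
    consider "card A = 1" | "card A = 2" using AB H by linarith
    then show ?thesis
    proof cases
      case 1
      then have "H = {}" using H finite_subset[OF H(1)] by (simp add: latent)
      moreover have "pick A 0 \<in> A" "pick B 0 \<in> B" using 1 AB by (simp_all only: pick_in_set_le)
      ultimately show ?thesis
        using prod0[of "pick A 0" "pick B 0"] 1 AB by (subst eval_sigma_minor_1) (auto simp: entry)
    next
      case 2
      then have cB: "card B = 2" using AB by simp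
      have "h1 \<notin> H \<or> h2 \<notin> H"
      proof (rule ccontr)
        assume "\<not> ?thesis"
        then have "H = {h1, h2}" using H(1) latent by auto
        then show False using H(2) 2 latent(2) by simp
      qed
      then have "\<exists>h. \<forall>i\<in>A. \<forall>j\<in>B. sym_entry ?y i j = L i h * L j h"
      proof
        assume "h1 \<notin> H"
        then show ?thesis using prod0(1) unfolding entry by (intro exI[of _ h2] ballI) simp
      next
        assume "h2 \<notin> H"
        then show ?thesis using prod0(2) unfolding entry by (intro exI[of _ h1] ballI) simp
      qed
      moreover have "pick A 0 \<in> A" "pick B 0 \<in> B" "pick A 1 \<in> A" "pick B 1 \<in> B"
        using 2 cB by (simp_all only: pick_in_set_le)
      ultimately show ?thesis
        unfolding eval_sigma_minor_2[OF AB(1,2) 2 cB] minor2_def by force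
    qed
  qed
  then have "separation_ideal G \<subseteq> ?I"
    unfolding separation_ideal_def Let_def
    by (intro ring.genideal_minimal[OF cring.axioms(1)[OF cring_poly_ring] ideal_vanishing_polys])
      (auto simp: sigma_minor_carrier)
  moreover obtain g k where f_eq: "f = g + k" and "g \<in> minors3_ideal ?p" "k \<in> separation_ideal G"
    using f by (auto simp: set_add_def' poly_ring_def)
  ultimately have "g \<in> ?I" "k \<in> ?I" by blast+
  then show ?thesis by (simp add: f_eq eval_poly_add)
qed

text \<open>Polynomials without diagonal variables take the same value with and without the diagonal
  part of the model.\<close>

lemma elimination_ideal_subset_invariants:
  "elimination_source \<inter> carrier (poly_ring (offdiag_vars (num_obs G))) \<subseteq> invariants G"
proof
  let ?p = "num_obs G"
  fix f assume f: "f \<in> elimination_source \<inter> carrier (poly_ring (offdiag_vars ?p))"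
  have "eval_poly (\<lambda>ij. S $$ ij) f = 0" if "S \<in> fa_model G" for S
  proof -
    have "\<exists>Om L. S = Om + mat ?p ?p (\<lambda>(i, j). \<Sum>h\<in>latent G. L i h * L j h) \<and>
        Om \<in> carrier_mat ?p ?p \<and> diagonal_mat Om \<and> (\<forall>i<?p. Om $$ (i, i) > 0) \<and> L \<in> fa_loadings G"
      using that unfolding fa_model_def Let_def by (rule CollectD)
    then obtain Om L where L: "L \<in> fa_loadings G" and Om: "Om \<in> carrier_mat ?p ?p" "diagonal_mat Om"
      and S: "S = Om + mat ?p ?p (\<lambda>(i, j). \<Sum>h\<in>latent G. L i h * L j h)"
      by (elim exE conjE) (rule that)
    have "vars f \<subseteq> offdiag_vars ?p" using f by (simp add: poly_ring_def)
    then have "eval_poly (\<lambda>ij. S $$ ij) f = eval_poly (\<lambda>(i, j). \<Sum>h\<in>latent G. L i h * L j h) f"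
      using Om by (intro eval_poly_cong) (auto simp: S offdiag_vars_def diagonal_mat_def)
    then show ?thesis using elimination_source_vanishes_at_loadings[OF L] f by simp
  qed
  then show "f \<in> invariants G" using f by (simp add: invariants_def)
qed

lemma invariants_vanish_on_variety_of_source:
  assumes y: "\<And>g. g \<in> elimination_source \<Longrightarrow> eval_poly y g = (0::complex)"
    and f: "f \<in> invariants G"
  shows "eval_poly y f = 0"
proof -
  let ?p = "num_obs G" and ?s = "sym_entry y"
  have zero: "0 \<in> minors3_ideal ?p" "0 \<in> separation_ideal G"
    using additive_subgroup.zero_closed[OF ideal.axioms(1)[OF ideal_minors3]]
      additive_subgroup.zero_closed[OF ideal.axioms(1)[OF ideal_separation]]
    by (simp_all add: poly_ring_def)
  have sum: "g + g' \<in> elimination_source" if "g \<in> minors3_ideal ?p" "g' \<in> separation_ideal G" for g g'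
    using that by (auto simp: set_add_def' poly_ring_def)
  have y3: "eval_poly y g = 0" if "g \<in> minors3_ideal ?p" for g
    using y[OF sum[OF that zero(2)]] by simp
  have ysep: "eval_poly y g = 0" if "g \<in> separation_ideal G" for g
    using y[OF sum[OF zero(1) that]] by simp
  have m3: "eval_poly y (sigma_minor ?p A B) = 0"
    if "A \<subseteq> {..<?p}" "B \<subseteq> {..<?p}" "card A = 3" "card B = 3" for A B
  proof (rule y3)
    show "sigma_minor ?p A B \<in> minors3_ideal ?p"
      unfolding minors3_ideal_def using that by (intro sigma_minor_in_genideal conjI)
  qed
  have minors: "minor3 ?s i j k l m n = 0"
    if "i < ?p" "j < ?p" "k < ?p" "l < ?p" "m < ?p" "n < ?p" for i j k l m n
    by (rule minors3_vanish[OF m3 that])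
  have sep: "eval_poly y (sigma_minor ?p A B) = 0"
    if "A \<subseteq> {..<?p}" "B \<subseteq> {..<?p}" "card A = card B" "card A \<le> 2"
      "H \<subseteq> latent G" "card H < card A" "separates G H A B" for A B H
  proof (rule ysep)
    have ex: "\<exists>H \<subseteq> latent G. card H < card A \<and> separates G H A B" using that by blast
    show "sigma_minor ?p A B \<in> separation_ideal G"
      unfolding separation_ideal_def Let_def using that ex by (intro sigma_minor_in_genideal conjI)
  qed
  have disjoint: "?s i j = 0"
    if "i < ?p" "j < ?p" "\<not> (child h1 i \<and> child h1 j)" "\<not> (child h2 i \<and> child h2 j)" for i j
  proof -
    have "separates G {} {i} {j}"
      using that in_parents[of "{i}"] in_parents[of "{j}"] by (auto simp: separates_def)
    then have "eval_poly y (sigma_minor ?p {i} {j}) = 0"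
      using that by (intro sep[of _ _ "{}"]) auto
    then show ?thesis
      using eval_sigma_minor_1[of "{i}" ?p "{j}" y] that by (simp only: pick_singleton) simp
  qed
  \<comment> \<open>If no node but \<open>h\<close> is a parent of \<open>i\<close> or
    \<open>j\<close>, then \<open>{h}\<close> separates \<open>{i, j}\<close> from every
    set.\<close>
  have single: "minor2 ?s i j k l = 0"
    if "i < ?p" "j < ?p" "k < ?p" "l < ?p" and h: "h \<in> latent G" "parents G {i, j} \<subseteq> {h}" for i j k l h
  proof (rule minor2_vanish)
    assume "i \<noteq> j" "k \<noteq> l"
    then show "eval_poly y (sigma_minor ?p {i, j} {k, l}) = 0"
      using that by (intro sep[of _ _ "{h}"]) (auto simp: separates_def)
  qed (use that in auto)
  have "\<exists>a b x z. \<forall>i<?p. \<forall>j<?p. ?s i j = gram (child h1) (child h2) a b x z (i, j)"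
  proof (rule gram_parametrization)
    show "?s i j = ?s j i" for i j by (simp add: sym_entry_def min.commute max.commute)
    show "minor2 ?s i j k l = 0" if "i < ?p" "j < ?p" "k < ?p" "l < ?p" "\<not> child h2 i" "\<not> child h2 j" for i j k l
      using that in_parents[of "{i, j}"] by (intro single[of _ _ _ _ h1]) (auto simp: latent)
    show "minor2 ?s i j k l = 0" if "i < ?p" "j < ?p" "k < ?p" "l < ?p" "\<not> child h1 i" "\<not> child h1 j" for i j k l
      using that in_parents[of "{i, j}"] by (intro single[of _ _ _ _ h2]) (auto simp: latent)
  qed (use minors disjoint in auto)
  then obtain a b x z where abxz: "\<forall>i<?p. \<forall>j<?p. ?s i j = gram (child h1) (child h2) a b x z (i, j)"
    by blast
  have "y (i, j) = gram (child h1) (child h2) a b x z (i, j)" if "i < j" "j < ?p" for i j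
    using abxz[rule_format, of i j] that by (simp add: sym_entry_def)
  moreover have "vars f \<subseteq> offdiag_vars ?p" using f by (simp add: invariants_def poly_ring_def)
  ultimately have "eval_poly y f = eval_poly (gram (child h1) (child h2) a b x z) f"
    by (intro eval_poly_cong) (auto simp: offdiag_vars_def subset_iff)
  also have "\<dots> = 0" by (rule gram_vanish_complex) (rule invariants_vanish_at_gram[OF f])
  finally show ?thesis .
qed

text \<open>Powers of \<open>f\<close> contain no diagonal variables, so one in the sum of the
  ideals would vanish at \<open>x\<close>. The point \<open>y\<close> given by the Nullstellensatz
  need not extend \<open>x\<close>; it only has to separate \<open>f\<close> from the ideal.\<close>

lemma invariants_vanish_on_elimination_variety:
  assumes x: "\<And>g. g \<in> elimination_source \<inter> carrier (poly_ring (offdiag_vars (num_obs G))) \<Longrightarrow>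
      eval_poly x g = (0::complex)"
    and f: "f \<in> invariants G"
  shows "eval_poly x f = 0"
proof (rule ccontr)
  let ?p = "num_obs G"
  assume nz: "eval_poly x f \<noteq> 0"
  interpret ev: comm_ring_hom "eval_poly x" by (rule comm_ring_hom_eval_poly)
  have vars: "vars f \<subseteq> offdiag_vars ?p" using f by (simp add: invariants_def poly_ring_def)
  have pow: "vars (f ^ n) \<subseteq> offdiag_vars ?p" for n
  proof (induction n)
    case (Suc n)
    then show ?case using vars vars_mult[of f "f ^ n"] by auto
  qed simp
  have "f ^ n \<notin> elimination_source" for n
    using x[of "f ^ n"] nz pow[of n] by (auto simp: poly_ring_def ev.hom_power)
  moreover have "f \<in> carrier (poly_ring (sym_vars ?p))"
    using vars by (force simp: poly_ring_def offdiag_vars_def sym_vars_def)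
  ultimately obtain y where "\<And>g. g \<in> elimination_source \<Longrightarrow> eval_poly y g = (0::complex)" "eval_poly y f \<noteq> 0"
    using nullstellensatz_poly_ring[OF ideal_elimination_source] by metis
  with invariants_vanish_on_variety_of_source[OF _ f] show False by blast
qed

end

theorem theorem3p4:
  fixes G :: "'h fa_graph" and p :: nat
  assumes "fa_graph G" and "card (latent G) = 2" and "num_obs G = p"
  shows "variety (offdiag_vars p) (invariants G) =
    variety (offdiag_vars p)
      ((minors3_ideal p <+>\<^bsub>poly_ring (sym_vars p)\<^esub> separation_ideal G)
        \<inter> carrier (poly_ring (offdiag_vars p)))"
proof -
  obtain h1 h2 where latent: "latent G = {h1, h2}" "h1 \<noteq> h2"
    using assms(2) by (auto simp: card_2_iff)
  show ?thesis
    using elimination_ideal_subset_invariants[OF latent]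
      invariants_vanish_on_elimination_variety[OF latent]
    unfolding variety_def assms(3) by blast
qed

end
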